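(* Any finite set of chambers in a semiregular right-angled building $\Delta$ is contained in a finite convex set of chambers of $\Delta$.
   Context: Let $I$ be a finite set and $M=(m_{ij})_{i,j\in I}$ a right-angled Coxeter matrix: $m_{ii}=1$ and $m_{ij}=m_{ji}\in\{2,\infty\}$ for $i\ne j$; let $W$ be the Coxeter group with generators $(s_i)_{i\in I}$. A (right-angled) building $\Delta$ of type $M$ is viewed as a chamber system: a set of chambers with an equivalence relation $\sim_i$ ($i$-adjacency) for each $i\in I$, all classes having at least two elements, and a map $\delta:\Delta\times\Delta\to W$ such that for each reduced word $s_{i_1}\cdots s_{i_k}$, $\delta(c,d)=s_{i_1}\cdots s_{i_k}$ iff there is a gallery $c=c_0\sim_{i_1}c_1\sim_{i_2}\cdots\sim_{i_k}c_k=d$ (consecutive chambers distinct) of type $(i_1,\dots,i_k)$. An $i$-panel is an equivalence class of $\sim_i$. $\Delta$ is semiregular with parameters $(q_i)_{i\in I}$ if every $i$-panel has the same (possibly infinite) cardinality $q_i\ge 2$. A set of chambers is convex if, for any two of its chambers $c,d$, it contains all chambers on all minimal-length galleries from $c$ to $d$. *)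

theory Defs
  imports "HOL-Library.Extended_Nat" "HOL-Algebra.Group"
begin

locale coxeter_matrix =
  fixes I :: "'i set" and m :: "'i \<Rightarrow> 'i \<Rightarrow> enat"
  assumes finite_index: "finite I"
    and m_diag: "\<And>i. i \<in> I \<Longrightarrow> m i i = 1"
    and m_sym: "\<And>i j. i \<in> I \<Longrightarrow> j \<in> I \<Longrightarrow> m i j = m j i"
    and m_off_diag: "\<And>i j. i \<in> I \<Longrightarrow> j \<in> I \<Longrightarrow> i \<noteq> j \<Longrightarrow> 2 \<le> m i j"

locale right_angled_coxeter_matrix = coxeter_matrix +
  assumes right_angled: "\<And>i j. i \<in> I \<Longrightarrow> j \<in> I \<Longrightarrow> i \<noteq> j \<Longrightarrow> m i j \<in> {2, \<infinity>}"

text \<open>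
  The congruence on words over \<open>I\<close> generated by the Coxeter relations
  \<open>(s\<^sub>i s\<^sub>j)\<^bsup>m i j\<^esup> = 1\<close> for \<open>m i j \<noteq> \<infinity>\<close>. As \<open>m i i = 1\<close>, it contains \<open>s\<^sub>i s\<^sub>i = 1\<close>, so
  the quotient monoid has inverses and is the group with this presentation.
\<close>

inductive_set coxeter_eq :: "'i set \<Rightarrow> ('i \<Rightarrow> 'i \<Rightarrow> enat) \<Rightarrow> ('i list \<times> 'i list) set"
  for I :: "'i set" and m :: "'i \<Rightarrow> 'i \<Rightarrow> enat" where
  refl: "w \<in> lists I \<Longrightarrow> (w, w) \<in> coxeter_eq I m"
| sym: "(v, w) \<in> coxeter_eq I m \<Longrightarrow> (w, v) \<in> coxeter_eq I m"
| trans: "(u, v) \<in> coxeter_eq I m \<Longrightarrow> (v, w) \<in> coxeter_eq I m \<Longrightarrow> (u, w) \<in> coxeter_eq I m"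
| relator: "u \<in> lists I \<Longrightarrow> v \<in> lists I \<Longrightarrow> i \<in> I \<Longrightarrow> j \<in> I \<Longrightarrow> m i j = enat n \<Longrightarrow>
    (u @ concat (replicate n [i, j]) @ v, u @ v) \<in> coxeter_eq I m"

definition coxeter_group :: "'i set \<Rightarrow> ('i \<Rightarrow> 'i \<Rightarrow> enat) \<Rightarrow> 'i list set monoid" where
  "coxeter_group I m =
    \<lparr>carrier = lists I // coxeter_eq I m,
     mult = (\<lambda>x y. \<Union>u\<in>x. \<Union>v\<in>y. coxeter_eq I m `` {u @ v}),
     one = coxeter_eq I m `` {[]}\<rparr>"

definition coxeter_gen :: "'i set \<Rightarrow> ('i \<Rightarrow> 'i \<Rightarrow> enat) \<Rightarrow> 'i \<Rightarrow> 'i list set" where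
  "coxeter_gen I m i = coxeter_eq I m `` {[i]}"

definition word_prod :: "'i set \<Rightarrow> ('i \<Rightarrow> 'i \<Rightarrow> enat) \<Rightarrow> 'i list \<Rightarrow> 'i list set" where
  "word_prod I m w =
    foldr (\<lambda>i x. coxeter_gen I m i \<otimes>\<^bsub>coxeter_group I m\<^esub> x) w \<one>\<^bsub>coxeter_group I m\<^esub>"

definition reduced_word :: "'i set \<Rightarrow> ('i \<Rightarrow> 'i \<Rightarrow> enat) \<Rightarrow> 'i list \<Rightarrow> bool" where
  "reduced_word I m w \<longleftrightarrow> w \<in> lists I \<and>
    (\<forall>v \<in> lists I. word_prod I m v = word_prod I m w \<longrightarrow> length w \<le> length v)"

lemma coxeter_eq_in_lists:
  assumes "(v, w) \<in> coxeter_eq I m" shows "v \<in> lists I \<and> w \<in> lists I"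
  using assms
proof induction
  case (relator u v i j n)
  then have "set (concat (replicate n [i, j])) \<subseteq> I" by (cases n) auto
  with relator show ?case by auto
qed auto

lemma equiv_coxeter_eq: "equiv (lists I) (coxeter_eq I m)"
proof (rule equivI)
  show "coxeter_eq I m \<subseteq> lists I \<times> lists I"
    using coxeter_eq_in_lists by fast
  show "refl_on (lists I) (coxeter_eq I m)"
    by (rule refl_onI) (rule coxeter_eq.refl)
  show "sym (coxeter_eq I m)"
    by (rule symI) (rule coxeter_eq.sym)
  show "trans (coxeter_eq I m)"
    by (rule transI) (rule coxeter_eq.trans)
qed

lemma coxeter_eq_append_left:
  assumes "(v, w) \<in> coxeter_eq I m" "u \<in> lists I"
  shows "(u @ v, u @ w) \<in> coxeter_eq I m"
  using assms
proof induction
  case (relator a b i j n)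
  then show ?case using coxeter_eq.relator[of "u @ a" I b i j m n] by simp
next
  case (refl w)
  then show ?case by (intro coxeter_eq.refl) auto
next
  case (sym v w)
  then show ?case by (blast intro: coxeter_eq.sym)
next
  case (trans x y z)
  then show ?case by (blast intro: coxeter_eq.trans)
qed

lemma coxeter_eq_append_right:
  assumes "(v, w) \<in> coxeter_eq I m" "u \<in> lists I"
  shows "(v @ u, w @ u) \<in> coxeter_eq I m"
  using assms
proof induction
  case (relator a b i j n)
  then show ?case using coxeter_eq.relator[of a I "b @ u" i j m n] by simp
next
  case (refl w)
  then show ?case by (intro coxeter_eq.refl) auto
next
  case (sym v w)
  then show ?case by (blast intro: coxeter_eq.sym)
next
  case (trans x y z)
  then show ?case by (blast intro: coxeter_eq.trans)
qed

lemma coxeter_eq_append: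
  assumes "(v, v') \<in> coxeter_eq I m" "(w, w') \<in> coxeter_eq I m"
  shows "(v @ w, v' @ w') \<in> coxeter_eq I m"
proof (rule coxeter_eq.trans)
  show "(v @ w, v' @ w) \<in> coxeter_eq I m"
    using coxeter_eq_append_right[OF assms(1)] coxeter_eq_in_lists[OF assms(2)] by blast
  show "(v' @ w, v' @ w') \<in> coxeter_eq I m"
    using coxeter_eq_append_left[OF assms(2)] coxeter_eq_in_lists[OF assms(1)] by blast
qed

lemma coxeter_mult_class:
  assumes "u \<in> lists I" "v \<in> lists I"
  shows "coxeter_eq I m `` {u} \<otimes>\<^bsub>coxeter_group I m\<^esub> coxeter_eq I m `` {v}
    = coxeter_eq I m `` {u @ v}"
proof -
  let ?R = "coxeter_eq I m"
  have "?R `` {u' @ v'} = ?R `` {u @ v}" if "u' \<in> ?R `` {u}" "v' \<in> ?R `` {v}" for u' v'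
  proof -
    have "(u @ v, u' @ v') \<in> ?R" using that by (auto intro: coxeter_eq_append)
    then show ?thesis by (rule equiv_class_eq[OF equiv_coxeter_eq, symmetric])
  qed
  moreover have "u \<in> ?R `` {u}" "v \<in> ?R `` {v}"
    using assms by (auto intro: coxeter_eq.refl)
  ultimately have "(\<Union>u'\<in>?R `` {u}. \<Union>v'\<in>?R `` {v}. ?R `` {u' @ v'}) = ?R `` {u @ v}"
    by blast
  then show ?thesis by (simp add: coxeter_group_def)
qed

lemma word_prod_eq_class:
  "w \<in> lists I \<Longrightarrow> word_prod I m w = coxeter_eq I m `` {w}"
proof (induction w)
  case Nil
  show ?case by (simp add: word_prod_def coxeter_group_def)
next
  case (Cons i w)
  then have "word_prod I m (i # w)
      = coxeter_eq I m `` {[i]} \<otimes>\<^bsub>coxeter_group I m\<^esub> coxeter_eq I m `` {w}"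
    by (simp add: word_prod_def coxeter_gen_def)
  also have "\<dots> = coxeter_eq I m `` {i # w}"
    using Cons.prems by (subst coxeter_mult_class) auto
  finally show ?case .
qed

context coxeter_matrix
begin

lemma coxeter_eq_rev_append: "w \<in> lists I \<Longrightarrow> (rev w @ w, []) \<in> coxeter_eq I m"
proof (induction w)
  case Nil
  show ?case by (auto intro: coxeter_eq.refl)
next
  case (Cons i w)
  then have "(rev w @ concat (replicate 1 [i, i]) @ w, rev w @ w) \<in> coxeter_eq I m"
    by (intro coxeter_eq.relator) (auto simp: m_diag one_enat_def)
  moreover have "(rev w @ w, []) \<in> coxeter_eq I m" using Cons by simp
  ultimately have "(rev w @ concat (replicate 1 [i, i]) @ w, []) \<in> coxeter_eq I m"
    by (rule coxeter_eq.trans)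
  then show ?case by simp
qed

lemma group_coxeter_group: "group (coxeter_group I m)"
proof (rule groupI)
  have carr: "carrier (coxeter_group I m) = (\<lambda>w. coxeter_eq I m `` {w}) ` lists I"
    by (auto simp: coxeter_group_def quotient_def)
  have one: "\<one>\<^bsub>coxeter_group I m\<^esub> = coxeter_eq I m `` {[]}"
    by (simp add: coxeter_group_def)
  note mult = coxeter_mult_class[of _ I _ m]
  show "\<one>\<^bsub>coxeter_group I m\<^esub> \<in> carrier (coxeter_group I m)"
    unfolding carr one by (rule imageI) simp
  have carrE: "\<exists>w \<in> lists I. x = coxeter_eq I m `` {w}"
    if "x \<in> carrier (coxeter_group I m)" for x
    using that unfolding carr by blast
  fix x assume "x \<in> carrier (coxeter_group I m)"
  then obtain u where u: "u \<in> lists I" "x = coxeter_eq I m `` {u}"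
    using carrE by blast
  show "\<one>\<^bsub>coxeter_group I m\<^esub> \<otimes>\<^bsub>coxeter_group I m\<^esub> x = x"
    unfolding one u(2) by (subst mult) (use u in simp_all)
  have r: "rev u \<in> lists I" using u by auto
  have "coxeter_eq I m `` {rev u} \<otimes>\<^bsub>coxeter_group I m\<^esub> x = \<one>\<^bsub>coxeter_group I m\<^esub>"
    unfolding one u(2) mult[OF r u(1)]
    using equiv_class_eq[OF equiv_coxeter_eq coxeter_eq_rev_append[OF u(1)]] .
  then show "\<exists>y\<in>carrier (coxeter_group I m).
      y \<otimes>\<^bsub>coxeter_group I m\<^esub> x = \<one>\<^bsub>coxeter_group I m\<^esub>"
    unfolding carr using r by blast
  fix y assume "y \<in> carrier (coxeter_group I m)"
  then obtain v where v: "v \<in> lists I" "y = coxeter_eq I m `` {v}"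
    using carrE by blast
  have uv: "u @ v \<in> lists I" using u v by simp
  show "x \<otimes>\<^bsub>coxeter_group I m\<^esub> y \<in> carrier (coxeter_group I m)"
    unfolding u(2) v(2) mult[OF u(1) v(1)] carr using uv by (rule imageI)
  fix z assume "z \<in> carrier (coxeter_group I m)"
  then obtain w where w: "w \<in> lists I" "z = coxeter_eq I m `` {w}"
    using carrE by blast
  have vw: "v @ w \<in> lists I" using v w by simp
  show "x \<otimes>\<^bsub>coxeter_group I m\<^esub> y \<otimes>\<^bsub>coxeter_group I m\<^esub> z
      = x \<otimes>\<^bsub>coxeter_group I m\<^esub> (y \<otimes>\<^bsub>coxeter_group I m\<^esub> z)"
    unfolding u(2) v(2) w(2) mult[OF u(1) v(1)] mult[OF v(1) w(1)]
      mult[OF uv w(1)] mult[OF u(1) vw] by simp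
qed

end

text \<open>A gallery is the list of its chambers, one longer than its type.\<close>

definition gallery ::
  "'i set \<Rightarrow> 'c set \<Rightarrow> ('i \<Rightarrow> ('c \<times> 'c) set) \<Rightarrow> 'i list \<Rightarrow> 'c list \<Rightarrow> bool" where
  "gallery I \<Delta> adj w cs \<longleftrightarrow>
    w \<in> lists I \<and> cs \<in> lists \<Delta> \<and> length cs = Suc (length w) \<and>
    (\<forall>k < length w. (cs ! k, cs ! Suc k) \<in> adj (w ! k) \<and> cs ! k \<noteq> cs ! Suc k)"

definition gallery_from_to ::
  "'i set \<Rightarrow> 'c set \<Rightarrow> ('i \<Rightarrow> ('c \<times> 'c) set) \<Rightarrow> 'c \<Rightarrow> 'i list \<Rightarrow> 'c list \<Rightarrow> 'c \<Rightarrow> bool" where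
  "gallery_from_to I \<Delta> adj c w cs d \<longleftrightarrow> gallery I \<Delta> adj w cs \<and> hd cs = c \<and> last cs = d"

definition minimal_gallery ::
  "'i set \<Rightarrow> 'c set \<Rightarrow> ('i \<Rightarrow> ('c \<times> 'c) set) \<Rightarrow> 'c \<Rightarrow> 'c list \<Rightarrow> 'c \<Rightarrow> bool" where
  "minimal_gallery I \<Delta> adj c cs d \<longleftrightarrow>
    (\<exists>w. gallery_from_to I \<Delta> adj c w cs d) \<and>
    (\<forall>w' cs'. gallery_from_to I \<Delta> adj c w' cs' d \<longrightarrow> length cs \<le> length cs')"

definition convex_chambers ::
  "'i set \<Rightarrow> 'c set \<Rightarrow> ('i \<Rightarrow> ('c \<times> 'c) set) \<Rightarrow> 'c set \<Rightarrow> bool" where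
  "convex_chambers I \<Delta> adj X \<longleftrightarrow> X \<subseteq> \<Delta> \<and>
    (\<forall>c \<in> X. \<forall>d \<in> X. \<forall>cs. minimal_gallery I \<Delta> adj c cs d \<longrightarrow> set cs \<subseteq> X)"

locale chamber_system =
  fixes I :: "'i set" and \<Delta> :: "'c set" and adj :: "'i \<Rightarrow> ('c \<times> 'c) set"
  assumes equiv_adj: "\<And>i. i \<in> I \<Longrightarrow> equiv \<Delta> (adj i)"
    and panel_two: "\<And>i P. i \<in> I \<Longrightarrow> P \<in> \<Delta> // adj i \<Longrightarrow> \<exists>c \<in> P. \<exists>d \<in> P. c \<noteq> d"

locale building = coxeter_matrix I m + chamber_system I \<Delta> adj
  for I :: "'i set" and m :: "'i \<Rightarrow> 'i \<Rightarrow> enat"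
    and \<Delta> :: "'c set" and adj :: "'i \<Rightarrow> ('c \<times> 'c) set" +
  fixes \<delta> :: "'c \<Rightarrow> 'c \<Rightarrow> 'i list set"
  assumes delta_closed:
      "\<And>c d. c \<in> \<Delta> \<Longrightarrow> d \<in> \<Delta> \<Longrightarrow> \<delta> c d \<in> carrier (coxeter_group I m)"
    and delta_eq_iff:
      "\<And>w c d. reduced_word I m w \<Longrightarrow> c \<in> \<Delta> \<Longrightarrow> d \<in> \<Delta> \<Longrightarrow>
        \<delta> c d = word_prod I m w \<longleftrightarrow> (\<exists>cs. gallery_from_to I \<Delta> adj c w cs d)"

locale right_angled_building =
  building I m \<Delta> adj \<delta> + right_angled_coxeter_matrix I m
  for I :: "'i set" and m :: "'i \<Rightarrow> 'i \<Rightarrow> enat"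
    and \<Delta> :: "'c set" and adj :: "'i \<Rightarrow> ('c \<times> 'c) set"
    and \<delta> :: "'c \<Rightarrow> 'c \<Rightarrow> 'i list set"

unbundle cardinal_syntax

text \<open>The parameters \<open>q i\<close> are cardinals, that is, cardinal orders on an arbitrary type.\<close>

definition semiregular ::
  "'i set \<Rightarrow> 'c set \<Rightarrow> ('i \<Rightarrow> ('c \<times> 'c) set) \<Rightarrow> ('i \<Rightarrow> 'q rel) \<Rightarrow> bool" where
  "semiregular I \<Delta> adj q \<longleftrightarrow>
    (\<forall>i \<in> I. Card_order (q i) \<and> ctwo \<le>o q i \<and> (\<forall>P \<in> \<Delta> // adj i. |P| =o q i))"

unbundle no cardinal_syntax

end

theory Submission
  imports Defs
begin

text \<open>
  The finite convex set is built one chamber at a time. Let \<open>Y\<close> be finite and convex, let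
  \<open>c \<in> Y\<close>, and let \<open>d\<close> be \<open>i\<close>-adjacent to \<open>c\<close>. Write \<open>R\<close> for the residue of \<open>d\<close> whose type
  is the set of generators \<open>j \<noteq> i\<close> that commute with \<open>i\<close>. The chambers of \<open>R\<close> that are
  \<open>i\<close>-adjacent to a chamber of \<open>Y\<close> form a copy of a part of \<open>Y\<close>, pushed through the wall
  that separates \<open>c\<close> from \<open>d\<close>. No two chambers of \<open>R\<close> lie in a common \<open>i\<close>-panel, so the copy is
  finite, even when the panels are infinite. The union of \<open>Y\<close> and the copy contains \<open>d\<close> and is
  again convex (\<open>geodesically_closed_extend\<close>). Since any two chambers are joined by a
  gallery, iterating this along galleries reaches all chambers of a finite set.

  That the union is convex need only be checked on pairs of chambers at distance two, because
  in the chamber graph a connected set that contains the midpoints of its geodesics of length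
  two contains all its geodesics (\<open>locally_convex_geodesically_closed\<close>). This local-to-global
  principle holds in every weakly modular graph, and the chamber graph has the two properties
  that it uses. Of two adjacent chambers at equal distance from \<open>x\<close>, the common panel
  contains a chamber nearer to \<open>x\<close> (\<open>panel_gate\<close>). Two neighbours of \<open>y\<close> that are both
  nearer to \<open>x\<close> than \<open>y\<close> and at the same distance from \<open>x\<close> have a common neighbour that is nearer
  still (\<open>quadrangle\<close>).
  At distance two, the check only involves minimal galleries of length at most three, and the
  single move that it needs is swapping two consecutive steps of commuting types.

  The quadrangle property comes from the Coxeter group: if a reduced word can be rewritten to
  end in \<open>i\<close> and also to end in \<open>j \<noteq> i\<close>, then \<open>i\<close> and \<open>j\<close> commute and it can be rewritten to end
  in \<open>i j\<close> (\<open>descents_commute\<close>, \<open>descents_end\<close>). This is derived from the exchange condition,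
  which in turn follows from the fact that the parity with which a reflection occurs
  along a word depends only on the group element.
\<close>

section \<open>Words in a right-angled Coxeter group\<close>

context right_angled_coxeter_matrix
begin

abbreviation weq :: "'a list \<Rightarrow> 'a list \<Rightarrow> bool" (infix "\<approx>" 50) where
  "v \<approx> w \<equiv> (v, w) \<in> coxeter_eq I m"

abbreviation reduced :: "'a list \<Rightarrow> bool" where
  "reduced \<equiv> reduced_word I m"

lemmas weq_sym = coxeter_eq.sym[of _ _ I m]
lemmas weq_trans [trans] = coxeter_eq.trans[of _ _ I m]
lemmas weq_lists = coxeter_eq_in_lists[of _ _ I m]
lemmas weq_append = coxeter_eq_append[of _ _ I m]

lemma weq_refl: "w \<in> lists I \<Longrightarrow> w \<approx> w"
  by (rule coxeter_eq.refl)

lemma word_prod_eq_iff: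
  "v \<in> lists I \<Longrightarrow> w \<in> lists I \<Longrightarrow> word_prod I m v = word_prod I m w \<longleftrightarrow> v \<approx> w"
  by (simp add: word_prod_eq_class eq_equiv_class_iff[OF equiv_coxeter_eq])

lemma reduced_iff: "reduced w \<longleftrightarrow> w \<in> lists I \<and> (\<forall>v. v \<approx> w \<longrightarrow> length w \<le> length v)"
  unfolding reduced_word_def using word_prod_eq_iff weq_lists by metis

lemma reduced_lists: "reduced w \<Longrightarrow> w \<in> lists I"
  by (simp add: reduced_iff)

lemma reduced_le: "reduced w \<Longrightarrow> v \<approx> w \<Longrightarrow> length w \<le> length v"
  by (simp add: reduced_iff)

lemma reduced_weq_length: "reduced v \<Longrightarrow> w \<approx> v \<Longrightarrow> length w = length v \<Longrightarrow> reduced w"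
  unfolding reduced_iff using weq_lists weq_trans by metis

lemma ex_reduced:
  assumes "w \<in> lists I"
  obtains v where "reduced v" "v \<approx> w"
proof -
  obtain v where "v \<approx> w" and v: "\<And>u. u \<approx> w \<Longrightarrow> length v \<le> length u"
    using ex_has_least_nat[of "\<lambda>v. v \<approx> w" w length] weq_refl[OF assms] by blast
  then have "reduced v"
    unfolding reduced_iff using weq_lists weq_trans by blast
  with \<open>v \<approx> w\<close> that show thesis by blast
qed

lemma reduced_append:
  assumes "reduced (u @ v)" shows "reduced u" "reduced v"
proof -
  have uv: "u \<in> lists I" "v \<in> lists I" using reduced_lists[OF assms] by auto
  have "length u \<le> length u'" if "u' \<approx> u" for u'
    using reduced_le[OF assms weq_append[OF that weq_refl[OF uv(2)]]] by simp
  then show "reduced u" using uv by (simp add: reduced_iff)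
  have "length v \<le> length v'" if "v' \<approx> v" for v'
    using reduced_le[OF assms weq_append[OF weq_refl[OF uv(1)] that]] by simp
  then show "reduced v" using uv by (simp add: reduced_iff)
qed

lemma reduced_Nil: "reduced []"
  by (simp add: reduced_iff)

lemma weq_cancel_left:
  assumes "u @ v \<approx> u @ w" shows "v \<approx> w"
proof -
  have l: "u \<in> lists I" "v \<in> lists I" "w \<in> lists I" using weq_lists[OF assms] by auto
  then have r: "rev u \<in> lists I" by auto
  have "v \<approx> rev u @ u @ v" and "rev u @ u @ w \<approx> w"
    using weq_append[OF coxeter_eq_rev_append[OF l(1)] weq_refl[OF l(2)]]
      weq_append[OF coxeter_eq_rev_append[OF l(1)] weq_refl[OF l(3)]] weq_sym by auto
  with weq_append[OF weq_refl[OF r] assms] show ?thesis using weq_trans by blast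
qed

lemma square_weq: "i \<in> I \<Longrightarrow> [i, i] \<approx> []"
  using coxeter_eq_rev_append[of "[i]"] by simp

lemma weq_square:
  assumes "i \<in> I" "u \<in> lists I" "v \<in> lists I" shows "u @ [i, i] @ v \<approx> u @ v"
  using weq_append[OF weq_append[OF weq_refl[OF assms(2)] square_weq[OF assms(1)]] weq_refl[OF assms(3)]]
  by simp

lemma weq_snoc: "v \<approx> w \<Longrightarrow> i \<in> I \<Longrightarrow> v @ [i] \<approx> w @ [i]"
  using weq_append[of v w "[i]" "[i]"] weq_refl[of "[i]"] by simp

lemma weq_snoc_snoc: "w \<in> lists I \<Longrightarrow> i \<in> I \<Longrightarrow> w @ [i, i] \<approx> w"
  using weq_square[of i w "[]"] by simp

lemma weq_snoc_move:
  assumes "v @ [i] \<approx> w" shows "v \<approx> w @ [i]"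
proof -
  have l: "v \<in> lists I" "i \<in> I" using weq_lists[OF assms] by auto
  have "v @ [i, i] \<approx> w @ [i]" using weq_snoc[OF assms l(2)] by simp
  with weq_sym[OF weq_snoc_snoc[OF l]] show ?thesis by (rule weq_trans)
qed

lemma weq_cong_left: "v \<approx> w \<Longrightarrow> v \<approx> r \<longleftrightarrow> w \<approx> r"
  using weq_sym weq_trans by metis

lemma commute_weq:
  assumes "i \<in> I" "j \<in> I" "m i j = 2" shows "[i, j] \<approx> [j, i]"
proof (rule weq_cancel_left)
  have "[i, j, i, j] \<approx> []"
    using coxeter_eq.relator[of "[]" I "[]" i j m 2] assms
    by (simp add: numeral_eq_Suc numeral_eq_enat)
  moreover have "[i, j, j, i] \<approx> []"
    using coxeter_eq_rev_append[of "[j, i]"] assms by simp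
  ultimately have "[i, j, i, j] \<approx> [i, j, j, i]"
    using weq_trans weq_sym by metis
  then show "[i, j] @ [i, j] \<approx> [i, j] @ [j, i]" by simp
qed

lemma relator_cases [consumes 3, case_names square commute]:
  assumes "i \<in> I" "j \<in> I" "m i j = enat n"
  obtains "i = j" "n = 1" | "i \<noteq> j" "n = 2" "m i j = 2"
proof (cases "i = j")
  case True
  then show thesis using assms m_diag[of i] that(1) by (simp add: one_enat_def)
next
  case False
  then show thesis using assms right_angled[of i j] that(2) by (auto simp: numeral_eq_enat)
qed

text \<open>
  A right action of the Coxeter group, given by involutions that commute when they should,
  yields an invariant of words; in the right-angled case there is nothing else to check.
\<close>

lemma weq_foldl:
  assumes inv: "\<And>i s. i \<in> I \<Longrightarrow> act (act s i) i = s"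
    and comm: "\<And>i j s. i \<in> I \<Longrightarrow> j \<in> I \<Longrightarrow> i \<noteq> j \<Longrightarrow> m i j = 2 \<Longrightarrow> act (act s i) j = act (act s j) i"
    and "v \<approx> w"
  shows "foldl act s v = foldl act s w"
  using assms(3)
proof (induction arbitrary: s)
  case (relator u v i j n)
  from relator(3-5) have "foldl act t (concat (replicate n [i, j])) = t" for t
  proof (cases rule: relator_cases)
    case square
    then show ?thesis using relator inv by simp
  next
    case commute
    then show ?thesis using relator inv comm[of i j] by (simp add: numeral_eq_Suc)
  qed
  then show ?case by simp
qed auto

lemma weq_parity:
  assumes "v \<approx> w" shows "even (length (filter P v)) = even (length (filter P w))"
proof -
  let ?act = "\<lambda>s i. if P i then \<not> s else s"
  have "foldl ?act s w = (s = even (length (filter P w)))" for s w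
    by (induction w arbitrary: s) auto
  with weq_foldl[of ?act, OF _ _ assms, of True] show ?thesis by auto
qed

lemma weq_even_length: "v \<approx> w \<Longrightarrow> even (length v) = even (length w)"
  using weq_parity[of v w "\<lambda>_. True"] by simp

text \<open>
  Deleting all letters outside a subset maps relators to relators or trivial words, since
  relators only square letters or commute them. So the special subgroup of the subset is a
  retract of the whole group.
\<close>

lemma weq_filter:
  assumes "v \<approx> w" shows "filter P v \<approx> filter P w"
  using assms
proof induction
  case (refl w)
  then show ?case by (intro weq_refl) auto
next
  case (relator u v i j n)
  have l: "filter P u \<in> lists I" "filter P v \<in> lists I" using relator by auto
  from relator(3-5) have "filter P (concat (replicate n [i, j])) \<approx> []"
  proof (cases rule: relator_cases)
    case square
    then show ?thesis using relator square_weq weq_refl by simp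
  next
    case commute
    have "[i, j, i, j] \<approx> []"
      using coxeter_eq.relator[of "[]" I "[]" i j m 2] relator commute
      by (simp add: numeral_eq_Suc numeral_eq_enat)
    then show ?thesis using commute relator square_weq weq_refl by (simp add: numeral_eq_Suc)
  qed
  with weq_append[OF weq_append[OF weq_refl[OF l(1)] this] weq_refl[OF l(2)]]
  show ?case by simp
qed (use weq_sym weq_trans in blast)+

text \<open>
  If \<open>v\<close> uses only letters of \<open>J\<close>, the retraction fixes the group element, while it strictly
  shortens any word for it that has a letter outside \<open>J\<close>.
\<close>

lemma reduced_support:
  assumes "reduced w" "v \<approx> w" "set v \<subseteq> J" shows "set w \<subseteq> J"
proof -
  have "filter (\<lambda>i. i \<in> J) v = v" using assms(3) by (auto simp: filter_id_conv)
  then have "filter (\<lambda>i. i \<in> J) w \<approx> w"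
    using weq_filter[OF assms(2), of "\<lambda>i. i \<in> J"] assms(2) weq_sym weq_trans by metis
  then have "length w \<le> length (filter (\<lambda>i. i \<in> J) w)" by (rule reduced_le[OF assms(1)])
  then have "filter (\<lambda>i. i \<in> J) w = w"
    using length_filter_less[of _ w "\<lambda>i. i \<in> J"] by (auto simp: filter_id_conv not_less[symmetric])
  then show ?thesis by (auto simp: filter_id_conv)
qed

subsection \<open>Exchange\<close>

text \<open>
  Reading a word \<open>u k w\<close> crosses, at the letter \<open>k\<close>, the wall of the reflection
  \<open>w\<^sup>-\<^sup>1 k w\<close>. The predicate says that the wall of the reflection \<open>r\<close> is crossed an odd number of
  times.
\<close>

primrec odd_refl :: "'a list \<Rightarrow> 'a list \<Rightarrow> bool" where
  "odd_refl [] r = False"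
| "odd_refl (k # w) r = ((rev w @ k # w \<approx> r) \<noteq> odd_refl w r)"

lemma rev_weq:
  assumes "w \<in> lists I" shows "w @ rev w \<approx> []"
  using coxeter_eq_rev_append[of "rev w"] assms by (simp add: in_lists_conv_set)

lemma conj_weq_iff:
  assumes "b \<in> lists I" "x \<in> lists I" "r \<in> lists I"
  shows "rev b @ x @ b \<approx> r \<longleftrightarrow> x \<approx> b @ r @ rev b"
proof
  have rb: "rev b \<in> lists I" using assms by auto
  note R = weq_refl[OF assms(1)] weq_refl[OF assms(2)] weq_refl[OF assms(3)] weq_refl[OF rb]
  { assume "rev b @ x @ b \<approx> r"
    from weq_append[OF R(1) weq_append[OF this R(4)]]
    have "(b @ rev b) @ x @ b @ rev b \<approx> b @ r @ rev b" by simp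
    moreover have "(b @ rev b) @ x @ b @ rev b \<approx> [] @ x @ []"
      by (intro weq_append rev_weq R assms)
    ultimately show "x \<approx> b @ r @ rev b" by (metis append_Nil append_Nil2 weq_cong_left) }
  { assume "x \<approx> b @ r @ rev b"
    from weq_append[OF R(4) weq_append[OF this R(1)]]
    have "rev b @ x @ b \<approx> (rev b @ b) @ r @ rev b @ b" by simp
    moreover have "(rev b @ b) @ r @ rev b @ b \<approx> [] @ r @ []"
      by (intro weq_append coxeter_eq_rev_append R assms)
    ultimately show "rev b @ x @ b \<approx> r" by (metis append_Nil append_Nil2 weq_cong_left) }
qed

lemma odd_refl_append:
  assumes "a \<in> lists I" "b \<in> lists I" "r \<in> lists I"
  shows "odd_refl (a @ b) r = (odd_refl a (b @ r @ rev b) \<noteq> odd_refl b r)"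
  using assms(1)
proof (induction a)
  case (Cons k a)
  then have "rev a @ k # a \<in> lists I" by auto
  from conj_weq_iff[OF assms(2) this assms(3)] Cons show ?case by auto
qed simp

lemma odd_refl_cong:
  assumes "r \<approx> r'" shows "odd_refl w r = odd_refl w r'"
proof -
  have "x \<approx> r \<longleftrightarrow> x \<approx> r'" for x
    using assms weq_sym weq_trans by metis
  then show ?thesis by (induction w) simp_all
qed

text \<open>
  A relator crosses each wall an even number of times: \<open>i i\<close> crosses one wall twice, and
  \<open>i j i j\<close> crosses the walls of \<open>i\<close> and \<open>j\<close> twice each when \<open>i\<close> and \<open>j\<close> commute.
\<close>

lemma odd_refl_weq:
  assumes "v \<approx> w" "r \<in> lists I" shows "odd_refl v r = odd_refl w r"
  using assms
proof (induction arbitrary: r)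
  case (relator u v i j n)
  let ?z = "concat (replicate n [i, j])"
  have zv: "?z @ v \<approx> v" using coxeter_eq.relator[of "[]" I v i j m n] relator by simp
  have z: "?z \<in> lists I" and z1: "?z \<approx> []"
    using coxeter_eq.relator[of "[]" I "[]" i j m n] relator weq_lists by (simp, force)+
  have r': "v @ r @ rev v \<in> lists I" using relator by auto
  have conj: "?z @ (v @ r @ rev v) @ rev ?z \<approx> v @ r @ rev v"
  proof -
    have "rev ?z \<in> lists I" using z by (simp only: in_lists_conv_set set_rev)
    from weq_append[OF z1 weq_refl[OF this]] have "?z @ rev ?z \<approx> rev ?z" by simp
    from weq_trans[OF weq_sym[OF this] rev_weq[OF z]] have "rev ?z \<approx> []" .
    from weq_append[OF z1 weq_append[OF weq_refl[OF r'] this]] show ?thesis by simp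
  qed
  have no: "\<not> odd_refl ?z s" if "s \<in> lists I" for s
    using relator(3-5)
  proof (cases rule: relator_cases)
    case square
    have "[i, i, i] \<approx> s \<longleftrightarrow> [i] \<approx> s"
      using weq_cong_left[OF weq_square[of i "[i]" "[]"]] relator(3) by simp
    then show ?thesis using square by simp
  next
    case commute
    note ij = relator(3,4)
    have c: "[i, j] \<approx> [j, i]" by (rule commute_weq[OF ij commute(3)])
    \<comment> \<open>the four walls crossed by \<open>i j i j\<close> are, from the right, those of \<open>j\<close>, \<open>c1\<close>, \<open>c3\<close>, \<open>c4\<close>\<close>
    have c1: "[j, i, j] \<approx> [i]"
      using weq_sym[OF weq_snoc_move[of "[i]" j "[j, i]"]] c ij by simp
    have c2: "[i, j, i] \<approx> [j]"
      using weq_sym[OF weq_snoc_move[of "[j]" i "[i, j]"]] weq_sym[OF c] ij by simp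
    have c3: "[j, i, j, i, j] \<approx> [j]"
      using weq_append[OF weq_append[OF weq_refl[of "[j]"] c2] weq_refl[of "[j]"]]
        weq_cong_left[OF weq_square[of j "[j]" "[]"]] weq_trans[of _ "[j, j, j]"] weq_square[of j "[j]" "[]"] ij by simp
    have c4: "[j, i, j, i, j, i, j] \<approx> [i]"
      using weq_append[OF c3 weq_refl[of "[i,j]"]] weq_cong_left[of _ "[j,i,j]"] c1 ij by simp
    from commute show ?thesis
      by (simp add: numeral_eq_Suc weq_cong_left[OF c1] weq_cong_left[OF c3] weq_cong_left[OF c4]) blast
  qed
  have zv': "?z @ v \<in> lists I" using weq_lists[OF zv] by simp
  have "odd_refl (u @ ?z @ v) r = (odd_refl u (?z @ (v @ r @ rev v) @ rev ?z) \<noteq> odd_refl (?z @ v) r)"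
    using odd_refl_append[OF relator(1) zv' relator(6)] by simp
  also have "odd_refl (?z @ v) r = odd_refl v r"
    using odd_refl_append[OF z relator(2) relator(6)] no[OF r'] by simp
  also have "odd_refl u (?z @ (v @ r @ rev v) @ rev ?z) = odd_refl u (v @ r @ rev v)"
    by (rule odd_refl_cong[OF conj])
  also have "(odd_refl u (v @ r @ rev v) \<noteq> odd_refl v r) = odd_refl (u @ v) r"
    using odd_refl_append[OF relator(1,2,6)] by simp
  finally show ?case .
next
  case (sym v w)
  then show ?case by (metis)
next
  case (trans u v w)
  then show ?case by (metis)
qed (rule HOL.refl)

lemma odd_refl_delete:
  assumes "odd_refl w [i]" "w \<in> lists I" "i \<in> I"
  obtains u k v where "w = u @ k # v" "w @ [i] \<approx> u @ v"
proof -
  have "\<exists>u k v. w = u @ k # v \<and> rev v @ k # v \<approx> [i]"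
    using assms(1)
  proof (induction w)
    case (Cons k w)
    show ?case
    proof (cases "odd_refl w [i]")
      case True
      with Cons obtain u k' v where "w = u @ k' # v" "rev v @ k' # v \<approx> [i]" by blast
      then show ?thesis by (intro exI[of _ "k # u"]) auto
    next
      case False
      with Cons show ?thesis by (intro exI[of _ "[]"]) auto
    qed
  qed simp
  then obtain u k v where w: "w = u @ k # v" and r: "rev v @ [k] @ v \<approx> [i]" by auto
  have l: "u \<in> lists I" "k \<in> I" "v \<in> lists I" using assms w by auto
  have "[k] \<approx> v @ [i] @ rev v"
    using conj_weq_iff[of v "[k]" "[i]"] r l assms by simp
  from weq_append[OF weq_append[OF weq_refl[OF l(1)] this] weq_refl[of "v @ [i]"]]
  have "u @ [k] @ v @ [i] \<approx> u @ v @ [i] @ rev v @ v @ [i]" using l assms by simp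
  also have "u @ v @ [i] @ rev v @ v @ [i] \<approx> u @ v @ [i] @ [] @ [i]"
    using weq_append[OF weq_refl[of "u @ v @ [i]"]
        weq_append[OF coxeter_eq_rev_append[OF l(3)] weq_refl[of "[i]"]]] l assms by simp
  also have "u @ v @ [i] @ [] @ [i] \<approx> u @ v"
    using weq_square[of i "u @ v" "[]"] l assms by simp
  finally show thesis using that[OF w] w by simp
qed

text \<open>
  If \<open>w i\<close> is not reduced, some word \<open>v\<close> for \<open>w i\<close> is shorter than \<open>w\<close>, and \<open>v i\<close> represents \<open>w\<close>.
  Since \<open>v\<close> and \<open>v i\<close> differ by one crossing of the wall of \<open>i\<close>, one of \<open>v\<close> and \<open>w\<close> crosses that
  wall oddly. For \<open>v\<close> this is impossible, as deleting the letter at the crossing would give a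
  word for \<open>w\<close> that is too short; for \<open>w\<close> the crossing gives the letter to delete.
\<close>

lemma exchange:
  assumes "reduced w" "i \<in> I" "\<not> reduced (w @ [i])"
  obtains u k v where "w = u @ k # v" "w @ [i] \<approx> u @ v"
proof (cases "odd_refl w [i]")
  case True
  then show thesis using that odd_refl_delete[OF True reduced_lists[OF assms(1)] assms(2)] by blast
next
  case False
  note w = reduced_lists[OF assms(1)]
  from assms(2,3) w obtain v where v: "v \<approx> w @ [i]" "length v < length (w @ [i])"
    unfolding reduced_iff by force
  then have len: "length v < length w" using weq_even_length[OF v(1)] by (auto simp: less_Suc_eq)
  have vl: "v \<in> lists I" using weq_lists[OF v(1)] by blast
  have vw: "v @ [i] \<approx> w"
    using weq_sym[OF weq_snoc_move[OF weq_sym[OF v(1)]]] .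
  have "odd_refl (v @ [i]) [i] = (odd_refl v [i, i, i] \<noteq> ([i] \<approx> [i]))"
    using odd_refl_append[OF vl, of "[i]" "[i]"] assms(2) by simp
  also have "odd_refl v [i, i, i] = odd_refl v [i]"
    by (rule odd_refl_cong) (use weq_square[of i "[i]" "[]"] assms(2) in simp)
  finally have "odd_refl v [i]"
    using False odd_refl_weq[OF vw, of "[i]"] assms(2) weq_refl[of "[i]"] by auto
  then obtain u k v' where u: "v = u @ k # v'" "v @ [i] \<approx> u @ v'"
    using odd_refl_delete[OF _ vl assms(2)] by blast
  then have "length w \<le> length (u @ v')" using reduced_le[OF assms(1)] vw weq_sym weq_trans by blast
  with u(1) len have False by simp
  then show thesis ..
qed

subsection \<open>Short words and pairs of descents\<close>

text \<open>
  The infinite dihedral group acts on the integers, seen as the chambers of a line whose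
  edges are labelled \<open>i\<close> and \<open>j\<close> in turn: each of the two generators moves every chamber to its
  neighbour across the edge with that label. All other generators act trivially. Each letter
  moves a chamber by at most one step, and alternating words move away steadily, so they are
  reduced.
\<close>

definition walk :: "'a \<Rightarrow> 'a \<Rightarrow> int \<Rightarrow> 'a \<Rightarrow> int" where
  "walk i j n k = (if k = i then (if even n then n + 1 else n - 1)
     else if k = j then (if even n then n - 1 else n + 1) else n)"

lemma weq_walk:
  assumes "m i j = \<infinity>" "i \<in> I" "j \<in> I" "v \<approx> w"
  shows "foldl (walk i j) n v = foldl (walk i j) n w"
  using assms(4)
proof (rule weq_foldl[rotated 2])
  show "walk i j (walk i j n k) k = n" for n k by (auto simp: walk_def)
  show "walk i j (walk i j n k) l = walk i j (walk i j n l) k"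
    if "k \<in> I" "l \<in> I" "k \<noteq> l" "m k l = 2" for n k l
    using that assms(1-3) m_sym[of i j] by (auto simp: walk_def)
qed

primrec alternating :: "'a \<Rightarrow> 'a \<Rightarrow> nat \<Rightarrow> 'a list" where
  "alternating i j 0 = []"
| "alternating i j (Suc n) = alternating i j n @ [if even n then i else j]"

lemma length_alternating [simp]: "length (alternating i j n) = n"
  by (induction n) auto

lemma alternating_lists: "i \<in> I \<Longrightarrow> j \<in> I \<Longrightarrow> alternating i j n \<in> lists I"
  by (induction n) auto

lemma walk_alternating: "i \<noteq> j \<Longrightarrow> foldl (walk i j) 0 (alternating i j n) = int n"
  by (induction n) (auto simp: walk_def)

lemma walk_le: "\<bar>foldl (walk i j) n w\<bar> \<le> \<bar>n\<bar> + int (length w)"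
proof (induction w arbitrary: n)
  case (Cons k w)
  have "\<bar>walk i j n k\<bar> \<le> \<bar>n\<bar> + 1" by (auto simp: walk_def)
  with Cons[of "walk i j n k"] show ?case by simp
qed simp

lemma alternating_reduced:
  assumes "m i j = \<infinity>" "i \<in> I" "j \<in> I" shows "reduced (alternating i j n)"
proof -
  have "i \<noteq> j" using assms m_diag[of i] by (auto simp: one_enat_def)
  have "n \<le> length v" if "v \<approx> alternating i j n" for v
    using weq_walk[OF assms that, of 0] walk_alternating[OF \<open>i \<noteq> j\<close>, of n] walk_le[of i j 0 v] by simp
  then show ?thesis using alternating_lists assms by (simp add: reduced_iff)
qed

text \<open>
  If \<open>i\<close> and \<open>j\<close> generate an infinite dihedral group, a reduced word \<open>w\<close> with both
  descents can be rewritten to end in arbitrarily long alternating words: exchanging the end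
  of \<open>y \<cdot> alternating\<close> against the next letter cannot delete inside the alternating part, whose
  one-letter extension is reduced, so it deletes a letter of \<open>y\<close>. This is absurd once
  the alternating part would be longer than \<open>w\<close>.
\<close>

lemma descents_commute:
  assumes a: "reduced (a @ [i])" and b: "reduced (b @ [j])" and ab: "a @ [i] \<approx> b @ [j]"
    and "i \<noteq> j"
  shows "m i j = 2"
proof (rule ccontr)
  have ij: "i \<in> I" "j \<in> I" using reduced_lists[OF a] reduced_lists[OF b] by auto
  assume "m i j \<noteq> 2"
  then have inf: "m i j = \<infinity>" using right_angled[OF ij \<open>i \<noteq> j\<close>] by auto
  let ?w = "a @ [i]"
  \<comment> \<open>both \<open>i\<close> and \<open>j\<close> shorten every reduced word for the element of \<open>?w\<close>\<close>
  have red: "reduced w \<Longrightarrow> w \<approx> ?w \<Longrightarrow> k \<in> {i, j} \<Longrightarrow> \<not> reduced (w @ [k])" for w k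
  proof
    assume w: "w \<approx> ?w" and k: "k \<in> {i, j}" and r: "reduced (w @ [k])"
    define c where "c = (if k = i then a else b)"
    have c: "w \<approx> c @ [k]" "length c < length ?w"
      using w weq_trans[OF w ab] k reduced_le[OF a weq_sym[OF ab]] reduced_le[OF b ab]
      by (auto simp: c_def)
    have "w @ [k] \<approx> c"
      using weq_sym[OF weq_snoc_move[OF weq_sym[OF c(1)]]] .
    from reduced_le[OF r weq_sym[OF this]] reduced_le[OF a w] c(2) show False by simp
  qed
  have "\<exists>y. length y + n = length ?w \<and> y @ alternating i j n \<approx> ?w" for n
  proof (induction n)
    case 0
    then show ?case using weq_refl[OF reduced_lists[OF a]] by (intro exI[of _ ?w]) simp
  next
    case (Suc n)
    let ?k = "if even n then i else j"
    obtain y where y: "length y + n = length ?w" "y @ alternating i j n \<approx> ?w" using Suc by blast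
    let ?v = "y @ alternating i j n"
    have rv: "reduced ?v" using reduced_weq_length[OF a y(2)] y(1) by simp
    have k: "?k \<in> I" "?k \<in> {i, j}" using ij by auto
    obtain u l v where d: "?v = u @ l # v" "?v @ [?k] \<approx> u @ v"
      using exchange[OF rv k(1) red[OF rv y(2) k(2)]] .
    from d(1)[unfolded append_eq_append_conv2] obtain us where us:
      "y = u @ us \<and> us @ alternating i j n = l # v \<or> y @ us = u \<and> alternating i j n = us @ l # v"
      by blast
    consider us where "y = u @ us" "l # v = us @ alternating i j n" "us \<noteq> []"
      | us where "u = y @ us" "alternating i j n = us @ l # v"
      using us that(1)[of us] that(2)[of us] by (cases "us = []") auto
    then show ?case
    proof cases
      \<comment> \<open>the letter is deleted in \<open>y\<close>\<close>
      case (1 us)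
      then obtain y' where y': "y = u @ l # y'" "v = y' @ alternating i j n"
        by (cases us) auto
      have "(u @ v) @ [?k] \<approx> ?v"
        by (rule weq_sym[OF weq_snoc_move[OF d(2)]])
      from weq_trans[OF this y(2)] have "(u @ y') @ alternating i j (Suc n) \<approx> ?w"
        using y'(2) by simp
      moreover have "length (u @ y') + Suc n = length ?w"
        using y(1) y'(1) by simp
      ultimately show ?thesis by blast
    next
      \<comment> \<open>the letter is deleted in the alternating part\<close>
      case (2 us)
      have "alternating i j (Suc n) \<approx> us @ v"
        by (rule weq_cancel_left[of y]) (use d(2) 2(1) in simp)
      from reduced_le[OF alternating_reduced[OF inf ij] weq_sym[OF this]]
      have "Suc n \<le> length (us @ v)" by simp
      moreover have "n = Suc (length (us @ v))"
        using arg_cong[OF 2(2), of length] by simp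
      ultimately show ?thesis by simp
    qed
  qed
  from this[of "Suc (length ?w)"] show False by auto
qed

lemma descents_end:
  assumes a: "reduced (a @ [i])" and b: "reduced (b @ [j])" and ab: "a @ [i] \<approx> b @ [j]"
    and "i \<noteq> j"
  obtains u where "u @ [i, j] \<approx> a @ [i]" "u @ [j] \<approx> a" "u @ [i] \<approx> b" "length a = Suc (length u)"
proof -
  have ij: "i \<in> I" "j \<in> I" using reduced_lists[OF a] reduced_lists[OF b] by auto
  have l: "a \<in> lists I" "b \<in> lists I" using reduced_lists[OF a] reduced_lists[OF b] by auto
  have len: "length a = length b" using reduced_le[OF b ab] reduced_le[OF a weq_sym[OF ab]] by simp
  have to_b: "(a @ [i]) @ [j] \<approx> b"
    using weq_sym[OF weq_snoc_move[OF weq_sym[OF ab]]] .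
  then have "\<not> reduced ((a @ [i]) @ [j])" using reduced_le[of "(a @ [i]) @ [j]" b] weq_sym len by auto
  then obtain u k v where d: "a @ [i] = u @ k # v" "(a @ [i]) @ [j] \<approx> u @ v"
    using exchange[OF a ij(2)] by blast
  \<comment> \<open>the final \<open>i\<close> is not the deleted letter, as \<open>i j\<close> is not trivial\<close>
  have "v \<noteq> []"
  proof
    assume "v = []"
    then have "a @ [i, j] \<approx> a @ []" using d by simp
    then have "[i, j] \<approx> []" by (rule weq_cancel_left)
    from weq_parity[OF this, of "\<lambda>k. k = i"] \<open>i \<noteq> j\<close> show False by simp
  qed
  then obtain v' where v: "v = v' @ [i]" "a = u @ k # v'"
    using d(1) by (cases v rule: rev_cases) auto
  have uv: "u @ v' \<in> lists I" using l v by auto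
  have b': "(u @ v') @ [i] \<approx> b" using weq_trans[OF weq_sym[OF d(2)] to_b] v by simp
  have *: "(u @ v') @ [i, j] \<approx> a @ [i]"
    using weq_trans[OF weq_snoc[OF b' ij(2)] weq_sym[OF ab]] by simp
  have c: "[j, i] \<approx> [i, j]" using commute_weq[OF ij descents_commute[OF assms]] weq_sym by blast
  have "(u @ v') @ [j, i] \<approx> a @ [i]"
    using weq_append[OF weq_refl[OF uv] c] * weq_trans by blast
  then have "((u @ v') @ [j]) @ [i] \<approx> a @ [i]" by simp
  then have "(u @ v') @ [j] \<approx> (a @ [i]) @ [i]" by (rule weq_snoc_move)
  then have "(u @ v') @ [j] \<approx> a @ [i, i]" by simp
  from weq_trans[OF this weq_snoc_snoc[OF l(1) ij(1)]] have "(u @ v') @ [j] \<approx> a" .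
  with that[OF * this b'] v show thesis by simp
qed

lemma reduced_single: "i \<in> I \<Longrightarrow> reduced [i]"
  by (auto simp: reduced_iff Suc_le_eq dest: weq_even_length)

lemma reduced_pair:
  assumes "i \<in> I" "j \<in> I" "i \<noteq> j" shows "reduced [i, j]"
proof -
  have "2 \<le> length v" if v: "v \<approx> [i, j]" for v
  proof (rule ccontr)
    assume "\<not> 2 \<le> length v"
    then have "v = []" using weq_even_length[OF v] by (cases v; cases "tl v") auto
    then show False using weq_parity[OF v, of "\<lambda>k. k = i"] assms by simp
  qed
  then show ?thesis using assms by (auto simp: reduced_iff numeral_eq_Suc)
qed

text \<open>
  A shorter word would be a single letter by parity of the length; parity of each letter then
  forces \<open>i = k\<close>, and the word alternates between letters that do not commute.
\<close>

lemma reduced_triple: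
  assumes "i \<in> I" "j \<in> I" "k \<in> I" "i \<noteq> j" "j \<noteq> k" "\<not> (i = k \<and> m i j = 2)"
  shows "reduced [i, j, k]"
proof (rule ccontr)
  assume "\<not> reduced [i, j, k]"
  moreover have "[i, j, k] \<in> lists I" using assms by simp
  ultimately obtain v where v: "v \<approx> [i, j, k]" "length v < 3"
    unfolding reduced_iff by force
  have "odd (length v)" using weq_even_length[OF v(1)] by simp
  with v(2) obtain l where l: "v = [l]"
    by (cases v; cases "tl v"; auto)
  have c: "even (length (filter (\<lambda>x. x = p) [l])) = even (length (filter (\<lambda>x. x = p) [i, j, k]))" for p
    using weq_parity[OF v(1), of "\<lambda>x. x = p"] l by simp
  have "i = k"
    using c[of i] c[of j] c[of k] assms(4,5) by (auto split: if_splits)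
  with assms(6) right_angled[OF assms(1,2,4)] have "m i j = \<infinity>" by simp
  from alternating_reduced[OF this, of 3] assms \<open>i = k\<close> have "reduced [i, j, k]"
    by (simp add: numeral_eq_Suc)
  with \<open>\<not> reduced [i, j, k]\<close> show False ..
qed

end

section \<open>Distances in a right-angled building\<close>

context right_angled_building
begin

definition adjacent :: "'i \<Rightarrow> 'c \<Rightarrow> 'c \<Rightarrow> bool" where
  "adjacent i c d \<longleftrightarrow> i \<in> I \<and> c \<in> \<Delta> \<and> d \<in> \<Delta> \<and> (c, d) \<in> adj i \<and> c \<noteq> d"

text \<open>
  Existence of a gallery of a given type, without mention of its chambers; the recursion on the
  type makes galleries easy to split and join.
\<close>

primrec path :: "'c \<Rightarrow> 'i list \<Rightarrow> 'c \<Rightarrow> bool" where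
  "path c [] d \<longleftrightarrow> c = d \<and> c \<in> \<Delta>"
| "path c (i # w) d \<longleftrightarrow> (\<exists>e. adjacent i c e \<and> path e w d)"

lemma adjacent_mem: "adjacent i c d \<Longrightarrow> i \<in> I \<and> c \<in> \<Delta> \<and> d \<in> \<Delta> \<and> c \<noteq> d"
  by (simp add: adjacent_def)

lemma adjacent_sym: "adjacent i c d \<Longrightarrow> adjacent i d c"
  using equiv_adj by (auto simp: adjacent_def equiv_def dest: symD)

lemma adjacent_trans: "adjacent i c d \<Longrightarrow> adjacent i d e \<Longrightarrow> c \<noteq> e \<Longrightarrow> adjacent i c e"
  using equiv_adj by (auto simp: adjacent_def equiv_def dest: transD)

lemma path_mem: "path c w d \<Longrightarrow> c \<in> \<Delta> \<and> d \<in> \<Delta> \<and> w \<in> lists I"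
  by (induction w arbitrary: c) (auto dest: adjacent_mem)

lemma path_append: "path c (v @ w) d \<longleftrightarrow> (\<exists>e. path c v e \<and> path e w d)"
proof (induction v arbitrary: c)
  case Nil
  then show ?case using path_mem by auto
qed auto

lemma path_snoc: "path c (w @ [i]) d \<longleftrightarrow> (\<exists>e. path c w e \<and> adjacent i e d)"
  using adjacent_mem by (fastforce simp: path_append)

lemma path_rev: "path c w d \<Longrightarrow> path d (rev w) c"
proof (induction w arbitrary: c)
  case (Cons i w)
  then show ?case using adjacent_sym by (fastforce simp: path_snoc)
qed simp

lemma gallery_Cons:
  "gallery I \<Delta> adj (i # w) (c # e # cs) \<longleftrightarrow> adjacent i c e \<and> gallery I \<Delta> adj w (e # cs)"
  unfolding gallery_def adjacent_def by (auto simp: All_less_Suc2)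

lemma gallery_Nil: "gallery I \<Delta> adj [] cs \<longleftrightarrow> (\<exists>c\<in>\<Delta>. cs = [c])"
  unfolding gallery_def by (auto simp: length_Suc_conv)

lemma gallery_ConsE:
  assumes "gallery I \<Delta> adj (i # w) cs"
  obtains c e cs' where "cs = c # e # cs'"
  using assms unfolding gallery_def by (auto simp: length_Suc_conv)

lemma path_iff_gallery: "path c w d \<longleftrightarrow> (\<exists>cs. gallery_from_to I \<Delta> adj c w cs d)"
proof (induction w arbitrary: c)
  case Nil
  show ?case by (auto simp: gallery_from_to_def gallery_Nil)
next
  case (Cons i w)
  show ?case
  proof
    assume "path c (i # w) d"
    then obtain e cs where e: "adjacent i c e" "gallery I \<Delta> adj w cs" "hd cs = e" "last cs = d"
      using Cons by (auto simp: gallery_from_to_def)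
    then have ne: "cs = e # tl cs" by (cases cs) (auto simp: gallery_def)
    with e have "gallery I \<Delta> adj (i # w) (c # cs)"
      using gallery_Cons[of i w c e "tl cs"] by simp
    moreover have "last (c # cs) = d" using e ne by (cases cs) auto
    ultimately show "\<exists>cs. gallery_from_to I \<Delta> adj c (i # w) cs d"
      unfolding gallery_from_to_def by (intro exI[of _ "c # cs"]) simp
  next
    assume "\<exists>cs. gallery_from_to I \<Delta> adj c (i # w) cs d"
    then obtain e cs where "gallery I \<Delta> adj (i # w) (c # e # cs)" "last (c # e # cs) = d"
      unfolding gallery_from_to_def by (metis gallery_ConsE list.sel(1))
    then show "path c (i # w) d"
      using Cons[of e] by (auto simp: gallery_Cons gallery_from_to_def)
  qed
qed

lemma gallery_path_through:
  assumes "gallery_from_to I \<Delta> adj c w cs d" "z \<in> set cs"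
  shows "\<exists>u v. w = u @ v \<and> path c u z \<and> path z v d"
  using assms
proof (induction w arbitrary: c cs)
  case Nil
  then show ?case by (auto simp: gallery_from_to_def gallery_Nil)
next
  case (Cons i w)
  from Cons.prems obtain e cs' where cs: "cs = c # e # cs'"
    unfolding gallery_from_to_def by (metis gallery_ConsE list.sel(1))
  with Cons.prems have e: "adjacent i c e" "gallery_from_to I \<Delta> adj e w (e # cs') d"
    by (auto simp: gallery_from_to_def gallery_Cons)
  show ?case
  proof (cases "z = c")
    case True
    have "path c (i # w) d" using Cons.prems path_iff_gallery by blast
    with True show ?thesis
      using path_mem[of c "i # w" d] by (intro exI[of _ "[]"] exI[of _ "i # w"]) simp
  next
    case False
    then obtain u v where "w = u @ v" "path e u z" "path z v d"
      using Cons.IH[OF e(2)] Cons.prems cs by auto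
    with e show ?thesis by (intro exI[of _ "i # u"] exI[of _ v]) auto
  qed
qed

lemma delta_eq_iff_path:
  "reduced w \<Longrightarrow> c \<in> \<Delta> \<Longrightarrow> d \<in> \<Delta> \<Longrightarrow> \<delta> c d = word_prod I m w \<longleftrightarrow> path c w d"
  using delta_eq_iff path_iff_gallery by simp

lemma path_weq:
  assumes "path c v d" "reduced v" "reduced w" "v \<approx> w" shows "path c w d"
  using assms delta_eq_iff_path[of v c d] delta_eq_iff_path[of w c d] path_mem[OF assms(1)]
    word_prod_eq_iff[of v w] reduced_lists by metis

lemma path_unique:
  assumes "path c v d" "path c w d" "reduced v" "reduced w" shows "v \<approx> w"
  using assms delta_eq_iff_path[of v c d] delta_eq_iff_path[of w c d] path_mem[OF assms(1)]
    word_prod_eq_iff[of v w] reduced_lists by metis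

lemma reduced_path_ex:
  assumes "c \<in> \<Delta>" "d \<in> \<Delta>" obtains w where "reduced w" "path c w d"
proof -
  obtain u where u: "u \<in> lists I" "\<delta> c d = coxeter_eq I m `` {u}"
    using delta_closed[OF assms] by (auto simp: coxeter_group_def quotient_def)
  obtain w where "reduced w" "w \<approx> u" using ex_reduced[OF u(1)] .
  moreover from this have "\<delta> c d = word_prod I m w"
    using u word_prod_eq_class word_prod_eq_iff[of w u] reduced_lists by metis
  ultimately show thesis using that delta_eq_iff_path assms by blast
qed

text \<open>
  If \<open>w i\<close> is not reduced, then \<open>w\<close> can be rewritten to end in \<open>i\<close>, so the \<open>i\<close>-panel of \<open>d\<close>
  contains a chamber \<open>e\<close> nearer to \<open>c\<close>; all other chambers of the panel have the same
  Weyl distance from \<open>c\<close> as \<open>d\<close>.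
\<close>

lemma path_turn:
  assumes "path c w d" "reduced w" "adjacent i d d'" "\<not> reduced (w @ [i])"
  obtains w' e where "reduced (w' @ [i])" "w' @ [i] \<approx> w" "path c w' e" "adjacent i e d"
    "e = d' \<or> path c w d'"
proof -
  have i: "i \<in> I" and w: "w \<in> lists I" using assms adjacent_mem reduced_lists by auto
  then obtain w' where w': "reduced w'" "w' \<approx> w @ [i]" using ex_reduced[of "w @ [i]"] by auto
  have ww: "w' @ [i] \<approx> w" using weq_sym[OF weq_snoc_move[OF weq_sym[OF w'(2)]]] .
  obtain v where "v \<approx> w @ [i]" "length v \<le> length w"
    using assms(4) i w unfolding reduced_iff by force
  then have "length w' \<le> length w"
    using reduced_le[OF w'(1)] weq_trans weq_sym[OF w'(2)] le_trans by metis
  then have "length (w' @ [i]) = length w"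
    using weq_even_length[OF ww] reduced_le[OF assms(2) ww] by (cases "length w' = length w") auto
  then have red: "reduced (w' @ [i])" by (rule reduced_weq_length[OF assms(2) ww])
  have "path c (w' @ [i]) d" using path_weq[OF assms(1,2) red weq_sym[OF ww]] .
  then obtain e where e: "path c w' e" "adjacent i e d" by (auto simp: path_snoc)
  have "path c w d'" if "e \<noteq> d'"
  proof -
    have "path c (w' @ [i]) d'"
      using e adjacent_trans[OF e(2) assms(3) that] by (auto simp: path_snoc)
    then show ?thesis using path_weq red assms(2) ww by blast
  qed
  with that[OF red ww e] show thesis by blast
qed

lemma path_reduce:
  assumes "path c w d"
  shows "\<exists>v. reduced v \<and> path c v d \<and> set v \<subseteq> set w \<and> length v \<le> length w"
  using assms
proof (induction w arbitrary: d rule: rev_induct)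
  case Nil
  then show ?case using reduced_Nil by auto
next
  case (snoc i w)
  then obtain d0 where d0: "path c w d0" "adjacent i d0 d" by (auto simp: path_snoc)
  obtain v where v: "reduced v" "path c v d0" "set v \<subseteq> set w" "length v \<le> length w"
    using snoc.IH[OF d0(1)] by blast
  show ?case
  proof (cases "reduced (v @ [i])")
    case True
    then show ?thesis using v d0 by (intro exI[of _ "v @ [i]"]) (auto simp: path_snoc)
  next
    case False
    obtain v' e where t: "reduced (v' @ [i])" "v' @ [i] \<approx> v" "path c v' e" "e = d \<or> path c v d"
      using path_turn[OF v(2,1) d0(2) False] by metis
    show ?thesis
    proof (cases "e = d")
      case True
      have "set v' \<subseteq> set v" using reduced_support[OF t(1) weq_sym[OF t(2)] order_refl] by auto
      moreover have "length (v' @ [i]) \<le> length v" using reduced_le[OF t(1) weq_sym[OF t(2)]] .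
      ultimately show ?thesis using True t reduced_append(1)[OF t(1)] v by (intro exI[of _ v']) auto
    next
      case False
      with t v show ?thesis by (intro exI[of _ v]) auto
    qed
  qed
qed

definition gal_dist :: "'c \<Rightarrow> 'c \<Rightarrow> nat" where
  "gal_dist c d = (LEAST n. \<exists>w. path c w d \<and> length w = n)"

lemma gal_dist_le: "path c w d \<Longrightarrow> gal_dist c d \<le> length w"
  unfolding gal_dist_def by (rule Least_le) blast

lemma gal_dist_reduced:
  assumes "path c w d" "reduced w" shows "gal_dist c d = length w"
  unfolding gal_dist_def
proof (rule Least_equality)
  show "\<exists>v. path c v d \<and> length v = length w" using assms by blast
  fix n assume "\<exists>v. path c v d \<and> length v = n"
  then obtain v where "path c v d" "length v = n" by blast
  then obtain v' where "reduced v'" "path c v' d" "length v' \<le> n" using path_reduce by blast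
  with path_unique[OF \<open>path c v' d\<close> assms(1) _ assms(2)] reduced_le[OF assms(2)]
  show "length w \<le> n" by fastforce
qed

lemma gal_dist_self: "c \<in> \<Delta> \<Longrightarrow> gal_dist c c = 0"
  using gal_dist_le[of c "[]" c] by simp

lemma gal_dist_0: "c \<in> \<Delta> \<Longrightarrow> d \<in> \<Delta> \<Longrightarrow> gal_dist c d = 0 \<Longrightarrow> c = d"
  using reduced_path_ex[of c d] gal_dist_reduced by (metis length_0_conv path.simps(1))

lemma gal_dist_sym:
  assumes "c \<in> \<Delta>" "d \<in> \<Delta>" shows "gal_dist c d = gal_dist d c"
proof -
  have "gal_dist d c \<le> gal_dist c d" if "c \<in> \<Delta>" "d \<in> \<Delta>" for c d
    using reduced_path_ex[OF that] gal_dist_reduced gal_dist_le path_rev by (metis length_rev)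
  with assms show ?thesis by (simp add: order_antisym)
qed

lemma gal_dist_triangle:
  assumes "c \<in> \<Delta>" "d \<in> \<Delta>" "e \<in> \<Delta>" shows "gal_dist c e \<le> gal_dist c d + gal_dist d e"
proof -
  obtain v where v: "reduced v" "path c v d" using reduced_path_ex assms by blast
  obtain w where w: "reduced w" "path d w e" using reduced_path_ex assms by blast
  have "path c (v @ w) e" using v w path_append by blast
  from gal_dist_le[OF this] show ?thesis using v w gal_dist_reduced by simp
qed

lemma gal_dist_1_iff: "c \<in> \<Delta> \<Longrightarrow> d \<in> \<Delta> \<Longrightarrow> gal_dist c d = 1 \<longleftrightarrow> (\<exists>i. adjacent i c d)"
proof
  assume "c \<in> \<Delta>" "d \<in> \<Delta>" and 1: "gal_dist c d = 1"
  then obtain w where w: "reduced w" "path c w d" using reduced_path_ex by blast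
  then have "length w = 1" using 1 gal_dist_reduced by simp
  then obtain i where "w = [i]" by (auto simp: length_Suc_conv)
  with w show "\<exists>i. adjacent i c d" by auto
next
  assume "\<exists>i. adjacent i c d"
  then obtain i where i: "adjacent i c d" by blast
  then show "gal_dist c d = 1"
    using gal_dist_reduced[of c "[i]" d] reduced_single adjacent_mem[OF i] by auto
qed

lemma adjacent_gal_dist: "adjacent i c d \<Longrightarrow> gal_dist c d = 1"
  using gal_dist_1_iff adjacent_mem by blast

lemma gal_dist_Suc:
  assumes "c \<in> \<Delta>" "d \<in> \<Delta>" "gal_dist c d = Suc n"
  obtains e where "e \<in> \<Delta>" "gal_dist c e = n" "gal_dist e d = 1"
proof -
  obtain w where w: "reduced w" "path c w d" using reduced_path_ex assms by blast
  then have "length w = Suc n" using assms(3) gal_dist_reduced by simp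
  then obtain v i where vi: "w = v @ [i]" "length v = n" by (cases w rule: rev_cases) auto
  then obtain e where e: "path c v e" "adjacent i e d" using w by (auto simp: path_snoc)
  then have "gal_dist c e = n" using gal_dist_reduced reduced_append(1) w vi by blast
  then show thesis using that e adjacent_gal_dist adjacent_mem by blast
qed

subsection \<open>Panels and squares seen from a chamber\<close>

lemma reduced_snoc_of_dist:
  assumes "path x w v" "reduced w" "adjacent i v y" "gal_dist x y = Suc (gal_dist x v)"
  shows "reduced (w @ [i])"
proof (rule ccontr)
  assume "\<not> reduced (w @ [i])"
  then obtain w' e where "reduced (w' @ [i])" "w' @ [i] \<approx> w" "path x w' e" "e = y \<or> path x w y"
    using path_turn[OF assms(1-3)] by metis
  then have "gal_dist x y \<le> length w"
    using gal_dist_le reduced_le[of "w' @ [i]" w] weq_sym by fastforce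
  then show False using assms(1,2,4) gal_dist_reduced by simp
qed

text \<open>
  A panel has at most one chamber nearest to \<open>x\<close>: if \<open>v\<close> is nearer than one other chamber of
  its \<open>i\<close>-panel, then \<open>i\<close> lengthens the word from \<open>x\<close> to \<open>v\<close>, and this does not depend on the other
  chamber.
\<close>

lemma gal_dist_panel:
  assumes "x \<in> \<Delta>" "adjacent i v y" "gal_dist x y = Suc (gal_dist x v)" "adjacent i v z"
  shows "gal_dist x z = Suc (gal_dist x v)"
proof -
  obtain w where w: "reduced w" "path x w v"
    using reduced_path_ex[OF assms(1)] adjacent_mem[OF assms(2)] by blast
  have "reduced (w @ [i])" using reduced_snoc_of_dist w assms by blast
  moreover have "path x (w @ [i]) z" using w assms path_snoc by blast
  ultimately show ?thesis using gal_dist_reduced w by fastforce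
qed

lemma panel_gate:
  assumes "x \<in> \<Delta>" "adjacent i v y" "gal_dist x v = gal_dist x y"
  obtains g where "adjacent i g v" "adjacent i g y" "Suc (gal_dist x g) = gal_dist x v"
proof -
  obtain w where w: "reduced w" "path x w v"
    using reduced_path_ex[OF assms(1)] adjacent_mem[OF assms(2)] by blast
  have "\<not> reduced (w @ [i])"
  proof
    assume "reduced (w @ [i])"
    moreover have "path x (w @ [i]) y" using w assms path_snoc by blast
    ultimately show False using gal_dist_reduced w assms(3) by fastforce
  qed
  then obtain w' e where t: "reduced (w' @ [i])" "w' @ [i] \<approx> w" "path x w' e" "adjacent i e v"
    using path_turn[OF w(2,1) assms(2)] by metis
  have l: "length w = Suc (length w')"
    using reduced_le[OF t(1) weq_sym[OF t(2)]] reduced_le[OF w(1) t(2)] by simp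
  have d: "gal_dist x e = length w'" "gal_dist x v = length w"
    using gal_dist_reduced t(3) reduced_append(1)[OF t(1)] w by auto
  with l assms(3) have "e \<noteq> y" by auto
  with that t(4) adjacent_trans[OF t(4) assms(2)] d l show thesis by simp
qed

lemma adjacent_swap:
  assumes "adjacent i a b" "adjacent j b c" "i \<noteq> j" "m i j = 2"
  obtains b' where "adjacent j a b'" "adjacent i b' c"
proof -
  have ij: "i \<in> I" "j \<in> I" using assms adjacent_mem by auto
  have "path a [i, j] c" using assms adjacent_mem by auto
  then have "path a [j, i] c"
    using path_weq reduced_pair[OF ij assms(3)] reduced_pair[OF ij(2,1)] commute_weq[OF ij assms(4)] assms(3)
    by metis
  then show thesis using that by auto
qed

text \<open>
  The words for \<open>x\<close> to \<open>y\<close> through \<open>v\<close> and through \<open>z\<close> end in different letters \<open>i\<close> and \<open>j\<close>,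
  which therefore commute, and \<open>u i j\<close> is a third reduced word from \<open>x\<close> to \<open>y\<close>. The
  end \<open>e\<close> of its part \<open>u\<close> completes the square with \<open>v\<close>, \<open>y\<close>, \<open>z\<close>, because a gallery of reduced
  type with given ends is unique.
\<close>

lemma quadrangle:
  assumes "x \<in> \<Delta>" "adjacent i v y" "adjacent j z y" "v \<noteq> z"
    and dv: "gal_dist x y = Suc (gal_dist x v)" and dz: "gal_dist x y = Suc (gal_dist x z)"
  obtains u where "u \<in> \<Delta>" "gal_dist u v = 1" "gal_dist u z = 1" "gal_dist x v = Suc (gal_dist x u)"
proof -
  obtain a where a: "reduced a" "path x a v"
    using reduced_path_ex[OF assms(1)] adjacent_mem[OF assms(2)] by blast
  obtain b where b: "reduced b" "path x b z"
    using reduced_path_ex[OF assms(1)] adjacent_mem[OF assms(3)] by blast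
  have ra: "reduced (a @ [i])" and rb: "reduced (b @ [j])"
    using reduced_snoc_of_dist a b assms by blast+
  have "path x (a @ [i]) y" "path x (b @ [j]) y" using a b assms path_snoc by blast+
  then have ab: "a @ [i] \<approx> b @ [j]" using path_unique ra rb by blast
  have ij: "i \<noteq> j"
  proof
    assume "i = j"
    then have "adjacent i v z" using adjacent_trans[OF assms(2)] adjacent_sym assms by blast
    from gal_dist_panel[OF assms(1,2) dv this] dv dz show False by simp
  qed
  obtain u where u: "u @ [j] \<approx> a" "u @ [i] \<approx> b" "length a = Suc (length u)"
    using descents_end[OF ra rb ab ij] by metis
  have lab: "length a = length b" using gal_dist_reduced a b dv dz by simp
  have ru: "reduced (u @ [j])" "reduced (u @ [i])"
    using reduced_weq_length[OF a(1) u(1)] reduced_weq_length[OF b(1) u(2)] u(3) lab by auto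
  then have "path x (u @ [j]) v" using path_weq[OF a(2,1)] u(1) weq_sym by blast
  then obtain e where e: "path x u e" "adjacent j e v" by (auto simp: path_snoc)
  have "m j i = 2" using descents_commute[OF ra rb ab ij] m_sym assms adjacent_mem by metis
  with e(2) assms(2) ij obtain z' where z': "adjacent i e z'" "adjacent j z' y"
    using adjacent_swap by metis
  have "path x (u @ [i]) z'" using e z' path_snoc by blast
  then have bz: "path x b z'" using path_weq ru(2) b(1) u(2) by blast
  have "z' = z"
  proof (rule ccontr)
    assume "z' \<noteq> z"
    then have "adjacent j z' z" using adjacent_trans[OF z'(2)] adjacent_sym assms by blast
    then have "path x (b @ [j]) z" using bz path_snoc by blast
    then show False using gal_dist_reduced[OF _ rb] gal_dist_reduced[OF b(2,1)] by fastforce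
  qed
  moreover have "gal_dist x e = length u" using gal_dist_reduced e reduced_append(1)[OF ru(1)] by blast
  moreover have "gal_dist x v = length a" using gal_dist_reduced a by blast
  ultimately show thesis using that[of e] e z' u(3) adjacent_gal_dist adjacent_mem by metis
qed

section \<open>Convexity is a local property\<close>

definition interval :: "'c \<Rightarrow> 'c \<Rightarrow> 'c set" where
  "interval x y = {z \<in> \<Delta>. gal_dist x z + gal_dist z y = gal_dist x y}"

text \<open>
  Convexity in terms of the gallery distance, where galleries no longer appear; it implies
  \<open>convex_chambers\<close> by \<open>geodesically_closed_convex\<close>.
\<close>

definition geodesically_closed :: "'c set \<Rightarrow> bool" where
  "geodesically_closed Y \<longleftrightarrow> Y \<subseteq> \<Delta> \<and> (\<forall>x\<in>Y. \<forall>y\<in>Y. interval x y \<subseteq> Y)"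

definition edges_in :: "'c set \<Rightarrow> ('c \<times> 'c) set" where
  "edges_in Y = {(x, y). x \<in> Y \<and> y \<in> Y \<and> gal_dist x y = 1}"

lemma geodesically_closed_convex:
  assumes "geodesically_closed Y" shows "convex_chambers I \<Delta> adj Y"
  unfolding convex_chambers_def
proof (intro conjI ballI allI impI subsetI)
  show "x \<in> \<Delta>" if "x \<in> Y" for x using that assms by (auto simp: geodesically_closed_def)
  fix c d cs z
  assume cd: "c \<in> Y" "d \<in> Y" and cs: "minimal_gallery I \<Delta> adj c cs d" and "z \<in> set cs"
  obtain w where w: "gallery_from_to I \<Delta> adj c w cs d" using cs by (auto simp: minimal_gallery_def)
  obtain u v where uv: "w = u @ v" "path c u z" "path z v d"
    using gallery_path_through[OF w \<open>z \<in> set cs\<close>] by blast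
  have mem: "c \<in> \<Delta>" "z \<in> \<Delta>" "d \<in> \<Delta>" using uv path_mem by auto
  obtain w' where w': "reduced w'" "path c w' d" using reduced_path_ex mem by blast
  obtain cs' where cs': "gallery_from_to I \<Delta> adj c w' cs' d" using w' path_iff_gallery by blast
  have "length cs \<le> length cs'" using cs cs' by (auto simp: minimal_gallery_def)
  then have "length w \<le> length w'" using w cs' by (simp add: gallery_from_to_def gallery_def)
  then have "gal_dist c z + gal_dist z d \<le> gal_dist c d"
    using gal_dist_le[OF uv(2)] gal_dist_le[OF uv(3)] uv(1) gal_dist_reduced[OF w'(2,1)] by simp
  then have "z \<in> interval c d" using gal_dist_triangle[of c z d] mem by (simp add: interval_def)
  then show "z \<in> Y" using assms cd by (auto simp: geodesically_closed_def)
qed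

lemma interval_mono:
  assumes "x \<in> \<Delta>" "y \<in> \<Delta>" "z \<in> interval x y" shows "interval x z \<subseteq> interval x y"
proof
  fix u assume "u \<in> interval x z"
  then show "u \<in> interval x y"
    using assms gal_dist_triangle[of u z y] gal_dist_triangle[of x u y] by (auto simp: interval_def)
qed

lemma end_in_interval: "x \<in> \<Delta> \<Longrightarrow> y \<in> \<Delta> \<Longrightarrow> y \<in> interval x y"
  by (simp add: interval_def gal_dist_self)

lemma interval_self: "x \<in> \<Delta> \<Longrightarrow> interval x x = {x}"
  using gal_dist_0[of x] by (auto simp: interval_def gal_dist_self)

lemma relpow_edges_interval:
  assumes "x \<in> \<Delta>" "y \<in> \<Delta>" "interval x y \<subseteq> Y"
  shows "(x, y) \<in> edges_in Y ^^ gal_dist x y"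
  using assms(2,3)
proof (induction "gal_dist x y" arbitrary: y)
  case 0
  then show ?case using gal_dist_0[OF assms(1) 0(2)] by simp
next
  case (Suc n)
  obtain e where e: "e \<in> \<Delta>" "gal_dist x e = n" "gal_dist e y = 1"
    using gal_dist_Suc[OF assms(1) Suc(3)] Suc(2) by metis
  then have ei: "e \<in> interval x y" using Suc(2) by (simp add: interval_def)
  then have "interval x e \<subseteq> Y" using interval_mono assms(1) Suc by blast
  then have "(x, e) \<in> edges_in Y ^^ n" using Suc(1)[of e] e by simp
  moreover have "(e, y) \<in> edges_in Y"
    using e ei Suc end_in_interval assms(1) by (auto simp: edges_in_def)
  ultimately show ?case unfolding Suc(2)[symmetric] by auto
qed

lemma relpow_edges_gal_dist:
  assumes "Y \<subseteq> \<Delta>" "(x, y) \<in> edges_in Y ^^ n" "x \<in> \<Delta>" shows "gal_dist x y \<le> n"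
  using assms(2)
proof (induction n arbitrary: y)
  case 0
  then show ?case using assms(3) by (simp add: gal_dist_self)
next
  case (Suc n)
  then obtain e where e: "(x, e) \<in> edges_in Y ^^ n" "(e, y) \<in> edges_in Y" by auto
  then have "e \<in> \<Delta>" "y \<in> \<Delta>" "gal_dist e y = 1" using assms(1) by (auto simp: edges_in_def)
  with Suc.IH[OF e(1)] gal_dist_triangle[of x e y] assms(3) show ?case by simp
qed

text \<open>
  By induction on the length \<open>n\<close> of a path inside \<open>Y\<close> from \<open>x\<close> to \<open>y\<close>, every geodesic from \<open>x\<close> to \<open>y\<close>
  stays in \<open>Y\<close>. Let \<open>v\<close> be the last chamber before \<open>y\<close>, so that all geodesics from \<open>x\<close> to \<open>v\<close>
  stay in \<open>Y\<close>. If \<open>y\<close> is as far from \<open>x\<close> as \<open>v\<close>, the gate of their panel lies in \<open>Y\<close> and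
  gives a shorter path to \<open>y\<close>. If \<open>y\<close> is farther and a geodesic enters \<open>y\<close> from \<open>t \<noteq> v\<close>, the
  quadrangle property gives a common neighbour \<open>u\<close> of \<open>v\<close> and \<open>t\<close>, which lies in \<open>Y\<close>; then \<open>t\<close>
  lies in \<open>Y\<close> as a midpoint of \<open>u\<close> and \<open>y\<close>, and the path through \<open>u\<close> to \<open>t\<close> is shorter than \<open>n\<close>.
\<close>

lemma locally_convex_geodesically_closed:
  assumes Y: "Y \<subseteq> \<Delta>"
    and conn: "\<And>x y. x \<in> Y \<Longrightarrow> y \<in> Y \<Longrightarrow> (x, y) \<in> (edges_in Y)\<^sup>*"
    and loc: "\<And>x y z. x \<in> Y \<Longrightarrow> y \<in> Y \<Longrightarrow> z \<in> \<Delta> \<Longrightarrow> gal_dist x y = 2 \<Longrightarrow> gal_dist x z = 1 \<Longrightarrow>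
      gal_dist z y = 1 \<Longrightarrow> z \<in> Y"
  shows "geodesically_closed Y"
proof -
  have "interval x y \<subseteq> Y" if "x \<in> Y" "y \<in> Y" "(x, y) \<in> edges_in Y ^^ n" for n x y
    using that
  proof (induction n arbitrary: x y rule: less_induct)
    case (less n)
    show ?case
    proof (cases n)
      case 0
      then have "y = x" using less.prems(3) by simp
      moreover have "interval x x = {x}" using interval_self less.prems(1) Y by blast
      ultimately show ?thesis using less.prems(1) by simp
    next
      case (Suc k)
      then obtain v where v: "(x, v) \<in> edges_in Y ^^ k" "(v, y) \<in> edges_in Y"
        using less.prems(3) by auto
      have mem: "x \<in> \<Delta>" "y \<in> \<Delta>" "v \<in> \<Delta>" "v \<in> Y" "gal_dist v y = 1"
        using v(2) less.prems(1,2) Y by (auto simp: edges_in_def)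
      have xv: "interval x v \<subseteq> Y"
        using less.IH[of k x v] Suc less.prems(1) v(1) mem(4) by simp
      \<comment> \<open>a neighbour \<open>b \<in> Y\<close> of a chamber \<open>a\<close> inside the interval is reached by a path shorter than \<open>n\<close>\<close>
      have short: "interval x b \<subseteq> Y" if "a \<in> interval x v" "b \<in> Y" "gal_dist a b = 1" "gal_dist x a < k" for a b
      proof -
        have a: "a \<in> \<Delta>" "a \<in> Y" using that xv by (auto simp: interval_def)
        have "interval x a \<subseteq> Y" using interval_mono[OF mem(1,3) that(1)] xv by blast
        then have "(x, a) \<in> edges_in Y ^^ gal_dist x a" using relpow_edges_interval mem a by blast
        then have "(x, b) \<in> edges_in Y ^^ Suc (gal_dist x a)"
          using that a by (auto simp: edges_in_def)
        then show ?thesis using less.IH[of "Suc (gal_dist x a)" x b] that less.prems(1) Suc by simp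
      qed
      have vk: "gal_dist x v \<le> k" using relpow_edges_gal_dist[OF Y] v(1) mem(1) by blast
      obtain i where i: "adjacent i v y" using mem gal_dist_1_iff by blast
      consider "Suc (gal_dist x y) = gal_dist x v" | "gal_dist x y = gal_dist x v" | "gal_dist x y = Suc (gal_dist x v)"
        using gal_dist_triangle[of x v y] gal_dist_triangle[of x y v] gal_dist_sym[of v y] mem by fastforce
      then show ?thesis
      proof cases
        case 1
        then have "y \<in> interval x v" using mem gal_dist_sym[of v y] by (simp add: interval_def)
        then show ?thesis using interval_mono[OF mem(1,3)] xv by blast
      next
        case 2
        obtain g where g: "adjacent i g v" "adjacent i g y" "Suc (gal_dist x g) = gal_dist x v"
          using panel_gate[OF mem(1) i] 2 by metis
        then have "g \<in> interval x v"
          using adjacent_gal_dist adjacent_mem by (fastforce simp: interval_def)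
        then show ?thesis using short[of g y] g(2,3) adjacent_gal_dist less.prems(2) vk by simp
      next
        case 3
        show ?thesis
        proof
          fix z assume z: "z \<in> interval x y"
          show "z \<in> Y"
          proof (cases "z = y")
            case True
            then show ?thesis using less.prems(2) by simp
          next
            case False
            have zm: "z \<in> \<Delta>" "gal_dist x z + gal_dist z y = gal_dist x y" using z by (auto simp: interval_def)
            then obtain l where l: "gal_dist z y = Suc l" using False gal_dist_0 mem by (cases "gal_dist z y") auto
            obtain t where t: "t \<in> \<Delta>" "gal_dist z t = l" "gal_dist t y = 1"
              using gal_dist_Suc[OF zm(1) mem(2) l] .
            have xt: "gal_dist x y = Suc (gal_dist x t)" and zt: "z \<in> interval x t"
              using gal_dist_triangle[of x z t] gal_dist_triangle[of x t y] zm t l mem by (auto simp: interval_def)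
            show ?thesis
            proof (cases "t = v")
              case True
              then show ?thesis using zt xv by blast
            next
              case False
              obtain j where j: "adjacent j t y" using t mem gal_dist_1_iff by blast
              obtain u where u: "u \<in> \<Delta>" "gal_dist u v = 1" "gal_dist u t = 1" "gal_dist x v = Suc (gal_dist x u)"
                using quadrangle[OF mem(1) i j _ 3 xt] False by metis
              then have ui: "u \<in> interval x v" by (simp add: interval_def)
              then have uY: "u \<in> Y" using xv by blast
              have "gal_dist u y = 2"
                using gal_dist_triangle[of x u y] gal_dist_triangle[of u t y] u t mem 3 by simp
              then have "t \<in> Y" using loc[OF uY less.prems(2) t(1)] u t by simp
              then show ?thesis using short[OF ui _ u(3)] u(4) vk zt by auto
            qed
          qed
        qed
      qed
    qed
  qed
  then show ?thesis
    using Y conn rtrancl_imp_relpow unfolding geodesically_closed_def by metis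
qed

section \<open>Enlarging a convex set across a wall\<close>

definition residue :: "'i set \<Rightarrow> 'c \<Rightarrow> 'c set" where
  "residue J d = {x. \<exists>w. set w \<subseteq> J \<and> path d w x}"

lemma residue_step:
  assumes "x \<in> residue J d" "adjacent j x z" "j \<in> J" shows "z \<in> residue J d"
proof -
  obtain w where "set w \<subseteq> J" "path d w x" using assms(1) by (auto simp: residue_def)
  then have "set (w @ [j]) \<subseteq> J" "path d (w @ [j]) z" using assms(2,3) by (auto simp: path_snoc)
  then show ?thesis unfolding residue_def by blast
qed

text \<open>
  Some word over \<open>J\<close> leads from \<open>x\<close> to \<open>y\<close> via \<open>d\<close>, and reduced words have the least support.
\<close>

lemma residue_word:
  assumes "x \<in> residue J d" "y \<in> residue J d" "path x w y" "reduced w"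
  shows "set w \<subseteq> J"
proof -
  obtain u v where u: "set u \<subseteq> J" "path d u x" and v: "set v \<subseteq> J" "path d v y"
    using assms by (auto simp: residue_def)
  have "path x (rev u @ v) y" using path_rev[OF u(2)] v path_append by blast
  then obtain w' where w': "reduced w'" "path x w' y" "set w' \<subseteq> set (rev u @ v)"
    using path_reduce by blast
  have "set w' \<subseteq> J" using w' u v by auto
  then show ?thesis using reduced_support[OF assms(4) path_unique[OF w'(2) assms(3) w'(1) assms(4)]] by blast
qed

definition perp :: "'i \<Rightarrow> 'i set" where
  "perp i = {j \<in> I. j \<noteq> i \<and> m i j = 2}"

text \<open>
  The part of \<open>Y\<close> next to the wall between \<open>d\<close> and its \<open>i\<close>-neighbour in \<open>Y\<close>, moved to the side
  of \<open>d\<close>.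
\<close>

definition parallel_copy :: "'c set \<Rightarrow> 'i \<Rightarrow> 'c \<Rightarrow> 'c set" where
  "parallel_copy Y i d = {x \<in> residue (perp i) d. \<exists>y\<in>Y. adjacent i x y}"

lemma finite_parallel_copy:
  assumes "finite Y" shows "finite (parallel_copy Y i d)"
proof -
  have "x = x'" if "x \<in> residue (perp i) d" "x' \<in> residue (perp i) d" "adjacent i x y" "adjacent i x' y"
    for x x' y
  proof (rule ccontr)
    assume "x \<noteq> x'"
    then have a: "adjacent i x x'" using that adjacent_trans adjacent_sym by blast
    then have "path x [i] x'" "reduced [i]" using adjacent_mem reduced_single by auto
    from residue_word[OF that(1,2) this] show False by (simp add: perp_def)
  qed
  then have "\<exists>z. {x \<in> residue (perp i) d. adjacent i x y} \<subseteq> {z}" for y by blast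
  then have "finite {x \<in> residue (perp i) d. adjacent i x y}" for y
    using finite_subset finite.emptyI finite_insert by metis
  moreover have "parallel_copy Y i d = (\<Union>y\<in>Y. {x \<in> residue (perp i) d. adjacent i x y})"
    by (auto simp: parallel_copy_def)
  ultimately show ?thesis using assms by simp
qed

lemma gal_dist_pair:
  assumes "adjacent i a b" "adjacent j b c" "i \<noteq> j" shows "gal_dist a c = 2"
proof -
  have "path a [i, j] c" using assms adjacent_mem by auto
  from gal_dist_reduced[OF this] reduced_pair assms adjacent_mem show ?thesis by fastforce
qed

lemma gal_dist_triple:
  assumes "adjacent i a b" "adjacent j b c" "adjacent k c d" "i \<noteq> j" "j \<noteq> k" "\<not> (i = k \<and> m i j = 2)"
  shows "gal_dist a d = 3"
proof -
  have "path a [i, j, k] d" using assms adjacent_mem by auto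
  from gal_dist_reduced[OF this] reduced_triple[of i j k] assms adjacent_mem show ?thesis by fastforce
qed

text \<open>
  Only midpoints \<open>z\<close> of geodesics \<open>x - z - y\<close> of types \<open>j \<noteq> k\<close> have to be found in the
  union. Suppose that \<open>x\<close> is in the copy, and let \<open>x0 \<in> Y\<close> be \<open>i\<close>-adjacent to it. The gallery
  \<open>x0 - x - z - y\<close> of type \<open>i j k\<close> is either minimal, or \<open>i = j\<close>, or \<open>i = k\<close> commutes with \<open>j\<close>. If
  \<open>y \<in> Y\<close>, convexity of \<open>Y\<close> gives \<open>z \<in> Y\<close> in the first two cases, and in the last one
  swapping \<open>i\<close> and \<open>j\<close> replaces \<open>x\<close> by a chamber of \<open>Y\<close> that is \<open>i\<close>-adjacent to \<open>z\<close>. If \<open>y\<close> also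
  lies in the copy, then \<open>j\<close> and \<open>k\<close> commute with \<open>i\<close>, and swapping twice moves the
  gallery from \<open>x\<close> to \<open>y\<close> across the wall, where its midpoint lies in \<open>Y\<close>.
\<close>

lemma geodesically_closed_extend:
  assumes Y: "geodesically_closed Y" and c: "c \<in> Y" and d: "adjacent i d c"
  shows "geodesically_closed (Y \<union> parallel_copy Y i d)" (is "geodesically_closed (Y \<union> ?S)")
proof (rule locally_convex_geodesically_closed)
  have Yd: "Y \<subseteq> \<Delta>" using Y by (simp add: geodesically_closed_def)
  have Yi: "z \<in> Y" if "x \<in> Y" "y \<in> Y" "z \<in> \<Delta>" "gal_dist x z + gal_dist z y = gal_dist x y" for x y z
    using Y that by (auto simp: geodesically_closed_def interval_def)
  have SI: "x \<in> ?S" if "x \<in> residue (perp i) d" "y \<in> Y" "adjacent i x y" for x y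
    using that by (auto simp: parallel_copy_def)
  have SE: "\<exists>y\<in>Y. adjacent i x y" "x \<in> residue (perp i) d" if "x \<in> ?S" for x
    using that by (auto simp: parallel_copy_def)
  show mem: "Y \<union> ?S \<subseteq> \<Delta>" using Yd SE adjacent_mem by blast

  show "(x, y) \<in> (edges_in (Y \<union> ?S))\<^sup>*" if xy: "x \<in> Y \<union> ?S" "y \<in> Y \<union> ?S" for x y
  proof -
    let ?E = "edges_in (Y \<union> ?S)"
    have YY: "(a, b) \<in> ?E\<^sup>*" if "a \<in> Y" "b \<in> Y" for a b
    proof -
      have "interval a b \<subseteq> Y \<union> ?S" using that Y by (auto simp: geodesically_closed_def)
      then have "(a, b) \<in> ?E ^^ gal_dist a b" using relpow_edges_interval that Yd by blast
      then show ?thesis by (rule relpow_imp_rtrancl)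
    qed
    have near: "\<exists>b\<in>Y. (a, b) \<in> ?E\<^sup>* \<and> (b, a) \<in> ?E\<^sup>*" if "a \<in> Y \<union> ?S" for a
    proof (cases "a \<in> Y")
      case False
      then have "a \<in> ?S" using that by blast
      then obtain b where b: "b \<in> Y" "adjacent i a b" using SE by blast
      then have "(a, b) \<in> ?E" "(b, a) \<in> ?E"
        using that adjacent_gal_dist[OF b(2)] adjacent_gal_dist[OF adjacent_sym[OF b(2)]]
        by (auto simp: edges_in_def)
      with b show ?thesis by blast
    qed blast
    obtain a b where "a \<in> Y" "(x, a) \<in> ?E\<^sup>*" "b \<in> Y" "(b, y) \<in> ?E\<^sup>*"
      using near[OF xy(1)] near[OF xy(2)] by blast
    with YY[of a b] show ?thesis by (meson rtrancl_trans)
  qed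

  have mixed: "z \<in> Y \<union> ?S"
    if x: "x \<in> ?S" and y: "y \<in> Y" and j: "adjacent j x z" and k: "adjacent k z y" and jk: "j \<noteq> k" for x y z j k
  proof -
    obtain x0 where x0: "x0 \<in> Y" "adjacent i x0 x" using SE(1)[OF x] adjacent_sym by blast
    have ijI: "i \<in> I" "j \<in> I" and zD: "z \<in> \<Delta>" and xD: "x \<in> \<Delta>"
      using x0 j adjacent_mem by auto
    consider "i = j" | "i = k" "m i j = 2" "i \<noteq> j" | "i \<noteq> j" "\<not> (i = k \<and> m i j = 2)" by blast
    then show ?thesis
    proof cases
      case 1
      show ?thesis
      proof (cases "x0 = z")
        case True
        then show ?thesis using x0 by simp
      next
        case False
        then have a: "adjacent i x0 z" using adjacent_trans[OF x0(2)] j 1 by blast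
        have "gal_dist x0 y = 2" using gal_dist_pair[OF a k] jk 1 by simp
        then have "z \<in> Y" using Yi[OF x0(1) y zD] adjacent_gal_dist[OF a] adjacent_gal_dist[OF k] by simp
        then show ?thesis ..
      qed
    next
      case 2
      obtain u where u: "adjacent j x0 u" "adjacent i u z"
        using adjacent_swap[OF x0(2) j 2(3,2)] .
      have "u \<in> Y"
      proof (cases "u = y")
        case False
        then have a: "adjacent i u y" using adjacent_trans[OF u(2)] k 2 by blast
        have "gal_dist x0 y = 2" using gal_dist_pair[OF u(1) a] 2 by simp
        then show ?thesis
          using Yi[OF x0(1) y, of u] adjacent_gal_dist[OF a] adjacent_gal_dist[OF u(1)] adjacent_mem[OF a] by simp
      qed (use y in simp)
      moreover have "z \<in> residue (perp i) d"
        using residue_step[OF SE(2)[OF x] j] 2 ijI by (simp add: perp_def)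
      ultimately show ?thesis using SI u(2) adjacent_sym by blast
    next
      case 3
      have "gal_dist x0 y = 3" using gal_dist_triple[OF x0(2) j k 3(1) jk 3(2)] .
      moreover have "gal_dist x y = 2" using gal_dist_pair[OF j k jk] .
      ultimately have xY: "x \<in> Y" using Yi[OF x0(1) y xD] adjacent_gal_dist[OF x0(2)] by simp
      then have "z \<in> Y" using Yi[OF xY y zD] \<open>gal_dist x y = 2\<close> adjacent_gal_dist[OF j] adjacent_gal_dist[OF k] by simp
      then show ?thesis ..
    qed
  qed

  fix x y z
  assume xy: "x \<in> Y \<union> ?S" "y \<in> Y \<union> ?S" and z: "z \<in> \<Delta>"
    and d2: "gal_dist x y = 2" and d1: "gal_dist x z = 1" "gal_dist z y = 1"
  have D: "x \<in> \<Delta>" "y \<in> \<Delta>" using xy mem by (simp_all only: subset_iff)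
  obtain j k where j: "adjacent j x z" and k: "adjacent k z y"
    using d1 gal_dist_1_iff[OF D(1) z] gal_dist_1_iff[OF z D(2)] by blast
  have jk: "j \<noteq> k"
  proof
    assume "j = k"
    then consider "x = y" | "adjacent j x y" using adjacent_trans[OF j] k by blast
    then show False using d2 adjacent_gal_dist[of j x y] gal_dist_self[OF D(1)] by cases simp_all
  qed
  consider "x \<in> Y" "y \<in> Y" | "x \<in> ?S" "y \<in> Y" | "x \<in> Y" "y \<in> ?S" | "x \<in> ?S" "y \<in> ?S"
    using xy by blast
  then show "z \<in> Y \<union> ?S"
  proof cases
    case 1
    then show ?thesis using Yi[of x y z] z d1 d2 by simp
  next
    case 2
    then show ?thesis using mixed j k jk by blast
  next
    case 3
    then show ?thesis using mixed[of y x k z j] adjacent_sym j k jk by blast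
  next
    case 4
    have "path x [j, k] y" using j k adjacent_mem by auto
    then have "{j, k} \<subseteq> perp i"
      using residue_word[OF SE(2)[OF 4(1)] SE(2)[OF 4(2)], of "[j, k]"]
        reduced_pair[OF _ _ jk] j k adjacent_mem by fastforce
    then have ij: "i \<noteq> j" "m i j = 2" "i \<noteq> k" "m i k = 2" "j \<in> perp i" by (auto simp: perp_def)
    obtain x0 where x0: "x0 \<in> Y" "adjacent i x0 x" using SE(1)[OF 4(1)] adjacent_sym by blast
    obtain y0 where y0: "y0 \<in> Y" "adjacent i y y0" using SE(1)[OF 4(2)] by blast
    obtain u where u: "adjacent j x0 u" "adjacent i u z"
      using adjacent_swap[OF x0(2) j ij(1,2)] .
    obtain v where v: "adjacent k u v" "adjacent i v y"
      using adjacent_swap[OF u(2) k ij(3,4)] .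
    have uD: "u \<in> \<Delta>" using u adjacent_mem by blast
    have "u \<in> Y"
    proof (cases "v = y0")
      case True
      then show ?thesis
        using Yi[OF x0(1) y0(1) uD] gal_dist_pair[OF u(1) v(1) jk] adjacent_gal_dist[OF u(1)] adjacent_gal_dist[OF v(1)]
        by simp
    next
      case False
      then have a: "adjacent i v y0" using adjacent_trans[OF v(2) y0(2)] by blast
      have "gal_dist x0 y0 = 3" using gal_dist_triple[OF u(1) v(1) a jk] ij by auto
      moreover have "gal_dist u y0 = 2" using gal_dist_pair[OF v(1) a] ij by auto
      ultimately show ?thesis using Yi[OF x0(1) y0(1) uD] adjacent_gal_dist[OF u(1)] by simp
    qed
    moreover have "z \<in> residue (perp i) d" using residue_step[OF SE(2)[OF 4(1)] j ij(5)] .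
    ultimately show ?thesis using SI u(2) adjacent_sym by blast
  qed
qed

lemma finite_geodesically_closed_path:
  assumes "path c w d" "geodesically_closed Y" "finite Y" "c \<in> Y"
  shows "\<exists>Z. Y \<subseteq> Z \<and> d \<in> Z \<and> finite Z \<and> geodesically_closed Z"
  using assms
proof (induction w arbitrary: c Y)
  case Nil
  then show ?case by auto
next
  case (Cons i w)
  then obtain e where e: "adjacent i c e" "path e w d" by auto
  let ?Z = "Y \<union> parallel_copy Y i e"
  have ei: "adjacent i e c" using adjacent_sym[OF e(1)] .
  have "path e [] e" using adjacent_mem[OF e(1)] by simp
  then have "e \<in> residue (perp i) e"
    unfolding residue_def by (intro CollectI exI[of _ "[]"]) simp
  then have "e \<in> ?Z" using ei Cons.prems by (auto simp: parallel_copy_def)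
  moreover have "finite ?Z" using finite_parallel_copy Cons.prems by blast
  moreover have "geodesically_closed ?Z" using geodesically_closed_extend[OF _ _ ei] Cons.prems by blast
  ultimately show ?case using Cons.IH[OF e(2), of ?Z] by blast
qed

lemma finite_geodesically_closed_superset:
  assumes "finite X" "X \<subseteq> \<Delta>"
  shows "\<exists>Y. X \<subseteq> Y \<and> finite Y \<and> geodesically_closed Y"
  using assms
proof (induction X)
  case empty
  show ?case by (intro exI[of _ "{}"]) (simp add: geodesically_closed_def)
next
  case (insert d X)
  then obtain Y where Y: "X \<subseteq> Y" "finite Y" "geodesically_closed Y" by blast
  show ?case
  proof (cases "Y = {}")
    case True
    have "geodesically_closed {d}"
      using insert.prems gal_dist_0 by (auto simp: geodesically_closed_def interval_def gal_dist_self)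
    then show ?thesis using True Y by (intro exI[of _ "{d}"]) auto
  next
    case False
    then obtain c where c: "c \<in> Y" by blast
    then have "c \<in> \<Delta>" "d \<in> \<Delta>" using Y insert.prems by (auto simp: geodesically_closed_def)
    then obtain w where "path c w d" using reduced_path_ex by blast
    from finite_geodesically_closed_path[OF this Y(3,2) c]
    obtain Z where "Y \<subseteq> Z" "d \<in> Z" "finite Z" "geodesically_closed Z" by blast
    then show ?thesis using Y(1) by (intro exI[of _ Z]) auto
  qed
qed

end

theorem lemma4p3:
  fixes I :: "'i set" and m :: "'i \<Rightarrow> 'i \<Rightarrow> enat"
    and \<Delta> :: "'c set" and adj :: "'i \<Rightarrow> ('c \<times> 'c) set"
    and \<delta> :: "'c \<Rightarrow> 'c \<Rightarrow> 'i list set" and q :: "'i \<Rightarrow> 'q rel"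
    and X :: "'c set"
  assumes "right_angled_building I m \<Delta> adj \<delta>"
    and "semiregular I \<Delta> adj q"
    and "X \<subseteq> \<Delta>" and "finite X"
  shows "\<exists>Y. X \<subseteq> Y \<and> finite Y \<and> convex_chambers I \<Delta> adj Y"
proof -
  interpret right_angled_building I m \<Delta> adj \<delta> by fact
  show ?thesis
    using finite_geodesically_closed_superset[OF assms(4,3)] geodesically_closed_convex by blast
qed

end
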